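(* Let $M$ be a 2D mesh such that each cell along its farfield has no more than $2$ farfield boundary faces, and such that the faces of each of its cells enclose a singular volume. Let $G=(V,E)$ be the cell centroid-based graph representation of $M$. Then the relative positions of all the nodes and faces of $M$ can be uniquely deduced from the following data on $G$: the cell volumes $\mathrm{V}_i$ for all $i\in V$, and the vectors $\mathbf{S}_{f,ij}$, $(\boldsymbol{c}_{f,ij}-\boldsymbol{x}_i)$ and $(\boldsymbol{c}_{f,ij}-\boldsymbol{x}_j)$ for all $(i,j)\in E$. Equivalently: if two such meshes $M$ and $M'$ have the same graph $G=(V,E)$ as their cell centroid-based graph representation, with the same data $\mathrm{V}_i$, $\mathbf{S}_{f,ij}$, $(\boldsymbol{c}_{f,ij}-\boldsymbol{x}_i)$, $(\boldsymbol{c}_{f,ij}-\boldsymbol{x}_j)$, then there is a translation of $\mathbb{R}^2$ carrying the mesh nodes of $M$ onto those of $M'$ and the faces of $M$ onto those of $M'$.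
   Context: A 2D mesh $M$ (as used in finite volume computational fluid dynamics) is a finite, connected, edge-to-edge subdivision of a planar domain into polygonal cells (e.g. triangles or quadrilaterals). The vertices of the cells are the mesh nodes. The faces are the line segments that form the sides of the cells, each face joining two mesh nodes. A face shared by two cells is an internal face; a face belonging to only one cell is a boundary face. The boundary of the domain consists of the farfield (the outer boundary of the simulation domain) and the geometry boundary (the boundary of any object immersed in the domain); a boundary face is accordingly a farfield boundary face or a geometry boundary face. Connectedness means that any two cells are linked by a chain of cells in which consecutive cells share a face. "The faces of a cell enclose a singular volume" means that the faces of the cell together form the boundary of one single enclosed region (a single closed polygon). Cell centroid: for a cell with mesh nodes $\boldsymbol{b}_1,\dots,\boldsymbol{b}_n$, its centroid is the arithmetic mean $\frac1n\sum_{k=1}^n \boldsymbol{b}_k$. Face centroid: for a face with mesh nodes $\boldsymbol{a},\boldsymbol{b}$, its centroid is $(\boldsymbol{a}+\boldsymbol{b})/2$. Cell centroid-based graph representation $G=(V,E)$: there is one graph node for each cell of $M$, located at the cell centroid, and one graph node for each geometry boundary face, located at the face centroid (the two types of graph node are distinguished). The location of graph node $i$ is denoted $\boldsymbol{x}_i$. For each internal face shared by two cells $i$ and $j$, $E$ contains the bidirectional edge $(i,j),(j,i)$; for each geometry boundary face $j$ of a cell $i$, $E$ contains the bidirectional edge $(i,j),(j,i)$. Farfield boundary faces are represented by neither graph nodes nor graph edges. Thus each graph edge corresponds to an internal or geometry boundary face of $M$. Data: for each cell $i$, $\mathrm{V}_i$ is the volume (in 2D, the area) of the cell. For $(i,j)\in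 E$, $\boldsymbol{c}_{f,ij}$ is the centroid of the corresponding face, and $\mathbf{S}_{f,ij}\in\mathbb{R}^2$ is its face area normal vector, i.e. the vector perpendicular to the face whose Euclidean norm is the length of the face, pointing outward from cell $i$. Relative positions: vectors $\boldsymbol{a}'_i$ are relative positions of points with absolute positions $\boldsymbol{a}_i$ if there is a constant vector $\alpha$ with $\boldsymbol{a}_i=\boldsymbol{a}'_i-\alpha$ for all $i$ (positions known up to a common translation). "Uniquely deduced" means uniquely determined, up to this common translation. *)

theory Defs
  imports "HOL-Analysis.Analysis"
begin

text \<open>
  The plane \<open>\<real>\<^sup>2\<close> is the type \<^typ>\<open>complex\<close>, the type for which HOL-Analysis has the Jordan curve
  theorem; only its structure as a Euclidean plane is used.

  A cell is its closed point set. A face is the set of its two end nodes, the line segment being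
  its convex hull.
\<close>

record mesh =
  cells :: "complex set set"
  faces :: "complex set set"

definition mesh_nodes :: "mesh \<Rightarrow> complex set" where
  "mesh_nodes M = \<Union> (faces M)"

definition cell_faces :: "mesh \<Rightarrow> complex set \<Rightarrow> complex set set" where
  "cell_faces M K = {f \<in> faces M. convex hull f \<subseteq> frontier K}"

definition cell_nodes :: "mesh \<Rightarrow> complex set \<Rightarrow> complex set" where
  "cell_nodes M K = \<Union> (cell_faces M K)"

definition face_adjacent :: "mesh \<Rightarrow> (complex set \<times> complex set) set" where
  "face_adjacent M = {(K, L). K \<in> cells M \<and> L \<in> cells M \<and> cell_faces M K \<inter> cell_faces M L \<noteq> {}}"

text \<open>
  A mesh. The condition on two faces of the same cell that meet in a node says that the nodes of
  a cell are true corners and its faces whole sides, as usual for edge-to-edge subdivisions: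
  a straight angle at a node would make it a hanging node in the middle of a side. Cells are
  not assumed here to be bounded by one closed polygon; see \<open>singular_volume\<close> below.
\<close>

definition is_mesh :: "mesh \<Rightarrow> bool" where
  "is_mesh M \<longleftrightarrow>
     finite (cells M) \<and> finite (faces M) \<and>
     (\<forall>f \<in> faces M. card f = 2) \<and>
     (\<forall>f \<in> faces M. \<forall>g \<in> faces M. f \<noteq> g \<longrightarrow> convex hull f \<inter> convex hull g = f \<inter> g) \<and>
     (\<forall>f \<in> faces M. \<exists>K \<in> cells M. f \<in> cell_faces M K) \<and>
     (\<forall>K \<in> cells M. K \<noteq> {} \<and> compact K \<and> connected K \<and> closure (interior K) = K \<and>
        frontier K = (\<Union>f \<in> cell_faces M K. convex hull f)) \<and>
     (\<forall>K \<in> cells M. \<forall>a b c. {a, b} \<in> cell_faces M K \<longrightarrow> {b, c} \<in> cell_faces M K \<longrightarrow> a \<noteq> c \<longrightarrow>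
        \<not> collinear {a, b, c}) \<and>
     (\<forall>K \<in> cells M. \<forall>L \<in> cells M. K \<noteq> L \<longrightarrow> interior K \<inter> interior L = {}) \<and>
     (\<forall>K \<in> cells M. \<forall>L \<in> cells M. (K, L) \<in> (face_adjacent M)\<^sup>*)"

text \<open>
  The faces of a cell form a single closed polygon. Since distinct faces of a mesh meet only in
  common end nodes, this polygon does not cross or touch itself.
\<close>

definition polygon_sides :: "complex list \<Rightarrow> complex set set" where
  "polygon_sides vs = {{vs ! k, vs ! (Suc k mod length vs)} | k. k < length vs}"

definition singular_volume :: "mesh \<Rightarrow> complex set \<Rightarrow> bool" where
  "singular_volume M K \<longleftrightarrow>
     (\<exists>vs. 3 \<le> length vs \<and> distinct vs \<and> cell_faces M K = polygon_sides vs)"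

definition boundary_faces :: "mesh \<Rightarrow> complex set set" where
  "boundary_faces M = {f. \<exists>!K. K \<in> cells M \<and> f \<in> cell_faces M K}"

text \<open>
  The farfield is the outer boundary of the domain: the part facing the unbounded component of
  the complement. The remaining boundary faces bound the holes, i.e. the immersed objects.
\<close>

definition farfield_faces :: "mesh \<Rightarrow> complex set set" where
  "farfield_faces M = {f \<in> boundary_faces M. convex hull f \<subseteq> frontier (outside (\<Union> (cells M)))}"

definition geometry_faces :: "mesh \<Rightarrow> complex set set" where
  "geometry_faces M = boundary_faces M - farfield_faces M"

definition centroid :: "complex set \<Rightarrow> complex" where
  "centroid N = (\<Sum>b \<in> N. b) /\<^sub>R real (card N)"

text \<open>The face area normal vector of a face \<open>f\<close> of the cell \<open>K\<close>, pointing outward from \<open>K\<close>.\<close>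

definition area_normal :: "complex set \<Rightarrow> complex set \<Rightarrow> complex" where
  "area_normal K f = (THE S.
     (\<forall>a b. f = {a, b} \<longrightarrow> S \<bullet> (b - a) = 0 \<and> norm S = dist a b) \<and>
     (\<forall>\<^sub>F t in at_right 0. centroid f + t *\<^sub>R S \<notin> K))"

datatype graph_node = is_Cell: Cell "complex set" | Geo "complex set"

definition graph_nodes :: "mesh \<Rightarrow> graph_node set" where
  "graph_nodes M = Cell ` cells M \<union> Geo ` geometry_faces M"

fun location :: "mesh \<Rightarrow> graph_node \<Rightarrow> complex" where
  "location M (Cell K) = centroid (cell_nodes M K)"
| "location M (Geo f) = centroid f"

text \<open>
  The faces of the mesh to which a pair of graph nodes corresponds. Two non-convex cells may
  share several faces; the edge then carries the data of each of them.
\<close>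

fun edge_faces :: "mesh \<Rightarrow> graph_node \<Rightarrow> graph_node \<Rightarrow> complex set set" where
  "edge_faces M (Cell K) (Cell L) =
     {f. K \<in> cells M \<and> L \<in> cells M \<and> K \<noteq> L \<and> f \<in> cell_faces M K \<inter> cell_faces M L}"
| "edge_faces M (Cell K) (Geo g) =
     {f. K \<in> cells M \<and> f = g \<and> f \<in> cell_faces M K \<inter> geometry_faces M}"
| "edge_faces M (Geo g) (Cell K) =
     {f. K \<in> cells M \<and> f = g \<and> f \<in> cell_faces M K \<inter> geometry_faces M}"
| "edge_faces M (Geo f) (Geo g) = {}"

definition graph_edges :: "mesh \<Rightarrow> (graph_node \<times> graph_node) set" where
  "graph_edges M = {(u, v). edge_faces M u v \<noteq> {}}"

text \<open>
  On an edge from a geometry boundary face to its cell, where there is no cell to point out of,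
  the normal is the negative of that on the reverse edge, as it is between two cells.
\<close>

fun edge_normal :: "graph_node \<Rightarrow> graph_node \<Rightarrow> complex set \<Rightarrow> complex" where
  "edge_normal (Cell K) v f = area_normal K f"
| "edge_normal (Geo g) (Cell K) f = - area_normal K f"
| "edge_normal (Geo g) (Geo h) f = 0"

text \<open>
  The triples \<open>(S\<^sub>f, c\<^sub>f - x\<^sub>u, c\<^sub>f - x\<^sub>v)\<close> of an edge \<open>(u, v)\<close>, one for each corresponding face \<open>f\<close>.
\<close>

definition edge_data :: "mesh \<Rightarrow> graph_node \<Rightarrow> graph_node \<Rightarrow> (complex \<times> complex \<times> complex) set" where
  "edge_data M u v =
     (\<lambda>f. (edge_normal u v f, centroid f - location M u, centroid f - location M v)) ` edge_faces M u v"

text \<open>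
  Two meshes have the same graph if their graph nodes can be identified by a bijection
  preserving the two types of graph node and the edges.
\<close>

definition graph_iso :: "mesh \<Rightarrow> mesh \<Rightarrow> (graph_node \<Rightarrow> graph_node) \<Rightarrow> bool" where
  "graph_iso M M' \<phi> \<longleftrightarrow>
     bij_betw \<phi> (graph_nodes M) (graph_nodes M') \<and>
     (\<forall>u \<in> graph_nodes M. is_Cell (\<phi> u) \<longleftrightarrow> is_Cell u) \<and>
     (\<forall>u \<in> graph_nodes M. \<forall>v \<in> graph_nodes M.
        (\<phi> u, \<phi> v) \<in> graph_edges M' \<longleftrightarrow> (u, v) \<in> graph_edges M)"

end

theory Submission
  imports Defs
begin

text \<open>
  A face of a cell is turned into a dart, the ordered pair of its end nodes that has the cell on its
  left; the centroid and the outward normal of a face amount to its dart. Where two faces of a cell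
  meet, one dart ends and the other begins, so the darts of a cell form one directed cycle. The data
  on the graph determine all but at most two darts of each cell, relative to its centroid.

  The visible darts determine where the paths of hidden darts begin and end. A single hidden dart is
  thus known. It cannot be confused with two consecutive ones, as the areas differ by that of a
  nondegenerate triangle. The node between two consecutive hidden darts is recovered from the
  centroid of the cell. Two hidden darts without a common node can be completed in two ways, but one
  of them gives two cycles instead of one. Finally, a face shared by two cells is known relative to
  both centroids, so that the translations of adjacent cells agree, and by connectedness all do.
\<close>

section \<open>Darts\<close>

text \<open>Farfield faces leave no trace in the graph, so not even the number of nodes of a cell is
  given. This is why centroid and area enter together. If \<open>b\<close> is the mean of the other
  nodes, replacing the dart from \<open>q\<close> to \<open>p\<close> by the path through
  \<open>b\<close> leaves the centroid unchanged, and only the area notices. Conversely, a given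
  area only confines \<open>b\<close> to a line parallel to that from \<open>q\<close> to
  \<open>p\<close>, and only the centroid fixes it. The bound of two enters because at most one node
  is then without visible darts, which is the single unknown that the centroid can supply.

  The comparison is always between two completions of one set \<open>E\<close> of visible darts.
  Every node has one incoming and one outgoing dart, so hidden paths start in
  \<open>Range E - Domain E\<close> and end in \<open>Domain E - Range E\<close>, whatever the
  completion.

  The edge data are bare sets of triples, without a matching of faces. A dart from \<open>a\<close>
  to \<open>b\<close> is recovered from its triple alone: the normal is \<open>b - a\<close> turned
  clockwise by a right angle, the centroid is half of \<open>a + b\<close>. The area becomes a
  function of the darts through the shoelace formula, proved by slicing the cell along vertical
  lines.\<close>

lemma inner_mult_self: "(q * d) \<bullet> d = Re q * (norm d)\<^sup>2" for q d :: complex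
  by (simp add: inner_complex_def cmod_power2 algebra_simps) (simp add: power2_eq_square algebra_simps)

text \<open>Together with \<open>inner_mult_self\<close>: a vector written as \<open>q * d\<close>
  has the coordinates \<open>Re q\<close> and \<open>Im q\<close> in the orthogonal frame
  \<open>d\<close>, \<open>\<i> * d\<close>, so orthogonal to \<open>d\<close> means
  \<open>Re q = 0\<close> and parallel to \<open>d\<close> means \<open>Im q = 0\<close>.\<close>

lemma inner_ii_mult: "(\<i> * d) \<bullet> (q * d) = Im q * (norm d)\<^sup>2"
  by (simp add: inner_complex_def cmod_power2 algebra_simps) (simp add: power2_eq_square algebra_simps)

text \<open>Positive if and only if \<open>w\<close> lies to the left of the line directed from \<open>a\<close> to \<open>b\<close>.\<close>

definition side :: "complex \<Rightarrow> complex \<Rightarrow> complex \<Rightarrow> real" where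
  "side a b w = (\<i> * (b - a)) \<bullet> (w - a)"

lemma side_swap: "side b a w = - side a b w"
  by (simp add: side_def inner_complex_def algebra_simps)

lemma side_swap_last: "side a c b = - side a b c"
  by (simp add: side_def inner_complex_def algebra_simps)

lemma side_affine: "side a b (a + s *\<^sub>R (w - a)) = s * side a b w"
  by (simp add: side_def)

lemma side_shift: "side a b (w + t *\<^sub>R (\<i> * (b - a))) = side a b w + t * (norm (b - a))\<^sup>2"
  by (simp add: side_def inner_diff_right inner_add_right power2_norm_eq_inner inner_complex_def algebra_simps)

lemma side_eq_0_imp_collinear:
  assumes "side a b c = 0"
  shows "collinear {a, b, c}"
proof (cases "a = b")
  case False
  define q where "q = (c - a) / (b - a)"
  have q: "c - a = q * (b - a)" using False by (simp add: q_def)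
  have "Im q * (norm (b - a))\<^sup>2 = 0"
    using assms unfolding side_def q inner_ii_mult .
  then have "Im q = 0" using False by simp
  then have "q = of_real (Re q)" by (simp add: complex_eq_iff)
  then have "c - a = Re q *\<^sub>R (b - a)" using q by (metis scaleR_conv_of_real)
  then have "collinear {0, b - a, c - a}" by (auto simp: collinear_lemma)
  then show ?thesis by (subst insert_commute, subst collinear_3) (simp)
qed auto

lemma side_convex_comb: "side a b ((1 - u) *\<^sub>R x + u *\<^sub>R y) = (1 - u) * side a b x + u * side a b y"
  by (simp add: side_def inner_complex_def) (simp add: algebra_simps)

lemma side_segment: "w \<in> closed_segment a b \<Longrightarrow> side a b w = 0"
  by (auto simp: closed_segment_def side_convex_comb) (simp add: side_def inner_complex_def algebra_simps)

text \<open>Near \<open>z\<close>, the set agrees with the left half-plane, except that the points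
  of the line itself are left open. Being a statement about a neighbourhood, it persists at all
  nearby points, which \<open>keeps_left_const\<close> exploits.\<close>

definition keeps_left :: "complex set \<Rightarrow> complex \<Rightarrow> complex \<Rightarrow> complex \<Rightarrow> bool" where
  "keeps_left K a b z \<longleftrightarrow>
     (\<forall>\<^sub>F w in nhds z. (side a b w > 0 \<longrightarrow> w \<in> K) \<and> (side a b w < 0 \<longrightarrow> w \<notin> K))"

lemma tendsto_side_shift:
  "((\<lambda>t. z + t *\<^sub>R (\<i> * (b - a))) \<longlongrightarrow> z) (at_right 0)"
  by (rule tendsto_eq_intros refl | simp)+

text \<open>A line has empty interior: a small step along the left normal
  \<open>\<i> * (b - a)\<close> leaves it without leaving the neighbourhood.\<close>

lemma ex_positive_side:
  assumes "\<forall>\<^sub>F w in nhds z. P w" "a \<noteq> b" "side a b z = 0"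
  shows "\<exists>w. P w \<and> side a b w > 0"
proof -
  have "\<forall>\<^sub>F t in at_right 0. P (z + t *\<^sub>R (\<i> * (b - a)))"
    using assms(1) tendsto_side_shift by (rule eventually_compose_filterlim)
  moreover have "\<forall>\<^sub>F t::real in at_right 0. t > 0"
    by (simp add: eventually_at_right_less)
  ultimately have "\<forall>\<^sub>F t in at_right 0. P (z + t *\<^sub>R (\<i> * (b - a))) \<and> t > 0"
    by eventually_elim simp
  then obtain t where "P (z + t *\<^sub>R (\<i> * (b - a)))" "t > 0"
    using eventually_happens[of _ "at_right (0::real)"] by (auto simp: trivial_limit_at_right_real)
  then show ?thesis using assms(2,3)
    by (intro exI[of _ "z + t *\<^sub>R (\<i> * (b - a))"]) (simp add: side_shift)
qed

lemma keeps_left_unique: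
  assumes "a \<noteq> b" "side a b z = 0" "keeps_left K a b z"
  shows "\<not> keeps_left K b a z"
proof
  assume "keeps_left K b a z"
  with assms(3) have "\<forall>\<^sub>F w in nhds z. \<not> side a b w > 0"
    unfolding keeps_left_def by eventually_elim (auto simp: side_swap[of b a])
  then show False using ex_positive_side[OF _ assms(1,2)] by blast
qed

section \<open>Orientation of the faces that bound a region\<close>

locale polygonal_region =
  fixes K :: "complex set" and F :: "complex set set"
  assumes compact: "compact K"
    and closure_interior: "closure (interior K) = K"
    and finite_faces: "finite F"
    and card_face: "f \<in> F \<Longrightarrow> card f = 2"
    and face_Int: "f \<in> F \<Longrightarrow> g \<in> F \<Longrightarrow> f \<noteq> g \<Longrightarrow> convex hull f \<inter> convex hull g = f \<inter> g"
    and frontier_eq: "frontier K = (\<Union>f \<in> F. convex hull f)"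
begin

lemma face_neq: "{a, b} \<in> F \<Longrightarrow> a \<noteq> b"
  using card_face[of "{a, b}"] by auto

lemma open_avoid_faces: "G \<subseteq> F \<Longrightarrow> open (- (\<Union>f \<in> G. convex hull f))"
proof -
  assume "G \<subseteq> F"
  then have "finite G" using finite_faces finite_subset by blast
  moreover have "closed (convex hull f)" if "f \<in> G" for f
  proof -
    have "finite f" using card_face that \<open>G \<subseteq> F\<close> by (metis card.infinite subsetD zero_neq_numeral)
    then show ?thesis by (intro compact_imp_closed finite_imp_compact_convex_hull)
  qed
  ultimately show ?thesis by (intro open_Compl closed_UN) auto
qed

lemma avoid_other_faces:
  assumes "{a, b} \<in> F" "z \<in> open_segment a b"
  shows "\<forall>\<^sub>F w in nhds z. w \<notin> (\<Union>f \<in> F - {{a, b}}. convex hull f)"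
proof -
  have "z \<notin> convex hull g" if "g \<in> F - {{a, b}}" for g
  proof
    assume "z \<in> convex hull g"
    moreover have "z \<in> convex hull {a, b}"
      using assms by (simp add: segment_convex_hull[symmetric] open_segment_def)
    ultimately have "z \<in> {a, b}" using face_Int[OF assms(1), of g] that by blast
    then show False using assms(2) by (auto simp: open_segment_def)
  qed
  then show ?thesis
    using open_avoid_faces[of "F - {{a, b}}"] by (auto simp: eventually_nhds)
qed

text \<open>In a small disc around an inner point of a face the frontier lies on one line, so each
  open half-disc, being connected, is inside or outside \<open>K\<close> as a whole. Both inside
  would make \<open>z\<close> an interior point; both outside would contradict
  \<open>closure (interior K) = K\<close>, which forbids slits and whiskers.\<close>

lemma keeps_left_cases:
  assumes f: "{a, b} \<in> F" and z: "z \<in> open_segment a b"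
  shows "keeps_left K a b z \<or> keeps_left K b a z"
proof -
  have ab: "a \<noteq> b" using face_neq f .
  have zs: "side a b z = 0" using z side_segment by (auto simp: open_segment_def)
  obtain e where e: "e > 0" "\<And>w. w \<in> ball z e \<Longrightarrow> w \<notin> (\<Union>f \<in> F - {{a, b}}. convex hull f)"
    using avoid_other_faces[OF f z] by (auto simp: eventually_nhds_metric dist_commute)
  have ev: "\<forall>\<^sub>F w in nhds z. w \<in> ball z e"
    using e(1) by (intro eventually_nhds_in_open) auto
  have fr: "side a b w = 0" if "w \<in> ball z e" "w \<in> frontier K" for w
    using e(2)[OF that(1)] that(2) side_segment[of w a b]
    by (auto simp: frontier_eq segment_convex_hull)
  have half: "ball z e \<inter> H \<subseteq> K \<or> ball z e \<inter> H \<inter> K = {}"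
    if "convex H" "\<And>w. w \<in> H \<Longrightarrow> side a b w \<noteq> 0" for H
    using connected_Int_frontier[OF convex_connected[OF convex_Int[OF convex_ball[of z e] that(1)]], of K] fr that(2)
    by blast
  define P where "P = {w. side a b w > 0}"
  define N where "N = {w. side b a w > 0}"
  have cv: "convex {w. side a b w > 0}" for a b
  proof -
    have "{w. side a b w > 0} = {w. (\<i> * (b - a)) \<bullet> w > (\<i> * (b - a)) \<bullet> a}"
      by (auto simp: side_def inner_diff_right)
    then show ?thesis by (simp add: convex_halfspace_gt)
  qed
  have hP: "ball z e \<inter> P \<subseteq> K \<or> ball z e \<inter> P \<inter> K = {}"
    by (rule half) (auto simp: P_def cv)
  have hN: "ball z e \<inter> N \<subseteq> K \<or> ball z e \<inter> N \<inter> K = {}"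
    by (rule half) (auto simp: N_def cv[of b a] side_swap[of a b])
  have zK: "z \<in> frontier K" using f z by (auto simp: frontier_eq segment_convex_hull open_segment_def)
  have "closed K" using compact compact_imp_closed by blast
  have not_both: "\<not> (ball z e \<inter> P \<subseteq> K \<and> ball z e \<inter> N \<subseteq> K)"
  proof
    assume A: "ball z e \<inter> P \<subseteq> K \<and> ball z e \<inter> N \<subseteq> K"
    \<comment> \<open>Points on the dividing line are in \<open>K\<close> too: as \<open>K\<close>
      is closed, a missing one would have missing neighbours in the half-disc
      \<open>P\<close>.\<close>
    have "w \<in> K" if w: "w \<in> ball z e" for w
    proof (rule ccontr)
      assume "w \<notin> K"
      then have "\<not> side a b w > 0" "\<not> side b a w > 0" using A w by (auto simp: P_def N_def)
      then have "side a b w = 0" by (simp add: side_swap[of b a])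
      moreover have "\<forall>\<^sub>F w' in nhds w. w' \<in> ball z e - K"
        using w \<open>w \<notin> K\<close> \<open>closed K\<close> by (intro eventually_nhds_in_open open_Diff) auto
      ultimately obtain w' where "w' \<in> ball z e - K" "side a b w' > 0"
        using ex_positive_side[of "\<lambda>w. w \<in> ball z e - K", OF _ ab] by blast
      then show False using A by (auto simp: P_def)
    qed
    then have "z \<in> interior K" using e(1) by (intro interiorI[of "ball z e"]) auto
    then show False using zK by (simp add: frontier_def)
  qed
  have not_none: "\<not> (ball z e \<inter> P \<inter> K = {} \<and> ball z e \<inter> N \<inter> K = {})"
  proof
    assume A: "ball z e \<inter> P \<inter> K = {} \<and> ball z e \<inter> N \<inter> K = {}"
    have "z \<in> closure (interior K)" using zK \<open>closed K\<close> by (simp add: closure_interior frontier_def)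
    then obtain w where w: "w \<in> interior K" "w \<in> ball z e"
      using e(1) by (auto simp: closure_approachable dist_commute)
    then have "side a b w = 0" using A interior_subset[of K] by (force simp: P_def N_def side_swap[of b a])
    moreover have "\<forall>\<^sub>F w' in nhds w. w' \<in> ball z e \<inter> interior K"
      using w by (intro eventually_nhds_in_open open_Int) auto
    ultimately obtain w' where "w' \<in> ball z e \<inter> interior K" "side a b w' > 0"
      using ex_positive_side[of "\<lambda>w. w \<in> ball z e \<inter> interior K", OF _ ab] by blast
    then show False using A interior_subset[of K] by (auto simp: P_def)
  qed
  consider "ball z e \<inter> P \<subseteq> K" "ball z e \<inter> N \<inter> K = {}"
    | "ball z e \<inter> N \<subseteq> K" "ball z e \<inter> P \<inter> K = {}"
    using hP hN not_both not_none by blast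
  then show ?thesis
  proof cases
    case 1
    then have "keeps_left K a b z" unfolding keeps_left_def using ev
      by (auto simp: P_def N_def side_swap[of b a] elim!: eventually_mono)
    then show ?thesis ..
  next
    case 2
    then have "keeps_left K b a z" unfolding keeps_left_def using ev
      by (auto simp: P_def N_def side_swap[of b a] elim!: eventually_mono)
    then show ?thesis ..
  qed
qed

text \<open>Both orientations are open conditions along the face, they exclude each other, and one
  of them always holds; hence the orientation is locally constant on a connected segment.\<close>

lemma keeps_left_const:
  assumes f: "{a, b} \<in> F" and z: "z \<in> open_segment a b" "z' \<in> open_segment a b"
    and l: "keeps_left K a b z"
  shows "keeps_left K a b z'"
proof -
  have "\<forall>\<^sub>F y in at x within open_segment a b. keeps_left K a b x = keeps_left K a b y"
    if x: "x \<in> open_segment a b" for x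
  proof -
    have s0: "side a b w = 0" if "w \<in> open_segment a b" for w
      using that side_segment by (auto simp: open_segment_def)
    have persist: "\<forall>\<^sub>F y in nhds x. keeps_left K c d y" if "keeps_left K c d x" for c d
      using that unfolding keeps_left_def
      by (subst (asm) eventually_eventually[symmetric])
    have "\<forall>\<^sub>F y in at x within open_segment a b. y \<in> open_segment a b"
      by (simp add: eventually_at_filter)
    moreover from keeps_left_cases[OF f x] consider "keeps_left K a b x" | "keeps_left K b a x" by blast
    then have "\<forall>\<^sub>F y in at x within open_segment a b. y \<in> open_segment a b \<longrightarrow>
        keeps_left K a b x = keeps_left K a b y"
    proof cases
      case 1
      then show ?thesis using persist[OF 1]
        unfolding eventually_at_filter by eventually_elim (simp add: 1)
    next
      case 2
      have "b \<noteq> a" using face_neq f by blast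
      then have "\<not> keeps_left K a b y" if "keeps_left K b a y" "y \<in> open_segment a b" for y
        using that s0[of y] keeps_left_unique[of b a y K] by (simp add: side_swap[of b a])
      with 2 x show ?thesis using persist[OF 2]
        unfolding eventually_at_filter by (auto elim!: eventually_mono)
    qed
    ultimately show ?thesis by eventually_elim auto
  qed
  then have "keeps_left K a b z = keeps_left K a b z'"
    by (intro connected_local_const[OF convex_connected[OF convex_open_segment] z]) auto
  then show ?thesis using l by simp
qed

text \<open>The condition at every inner point, rather than at the midpoint only, is what the corner
  argument (near a node) and the slicing argument (at any abscissa) call upon; one point suffices to
  establish it, by \<open>keeps_left_const\<close>.\<close>

definition darts :: "(complex \<times> complex) set" where
  "darts = {(a, b). {a, b} \<in> F \<and> (\<forall>z \<in> open_segment a b. keeps_left K a b z)}"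

lemma darts_cases: "{a, b} \<in> F \<Longrightarrow> (a, b) \<in> darts \<or> (b, a) \<in> darts"
proof -
  assume f: "{a, b} \<in> F"
  then have f': "{b, a} \<in> F" by (simp add: insert_commute)
  have ab: "a \<noteq> b" using face_neq f .
  then have z: "midpoint a b \<in> open_segment a b" by simp
  show ?thesis using keeps_left_cases[OF f z]
    unfolding darts_def using f f' keeps_left_const[OF f z] keeps_left_const[OF f', of "midpoint a b"] z
    by (auto simp: open_segment_commute)
qed

lemma darts_face: "(a, b) \<in> darts \<Longrightarrow> {a, b} \<in> F"
  by (simp add: darts_def)

lemma darts_asym: "(a, b) \<in> darts \<Longrightarrow> (b, a) \<notin> darts"
proof
  assume A: "(a, b) \<in> darts" "(b, a) \<in> darts"
  have ab: "a \<noteq> b" using face_neq darts_face A by blast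
  then have z: "midpoint a b \<in> open_segment a b" by simp
  then have "side a b (midpoint a b) = 0" using side_segment by (auto simp: open_segment_def)
  then show False using A z keeps_left_unique[OF ab, of "midpoint a b" K]
    by (auto simp: darts_def open_segment_commute[of b a])
qed

text \<open>Direction and length leave two candidates, the quarter turns of \<open>b - a\<close>.
  The turn to the left points into \<open>K\<close> at the midpoint, so the description in
  \<open>area_normal\<close> singles out the other.\<close>

lemma area_normal_dart:
  assumes d: "(a, b) \<in> darts"
  shows "area_normal K {a, b} = - (\<i> * (b - a))"
proof -
  have ab: "a \<noteq> b" using d darts_face face_neq by blast
  define z where "z = midpoint a b"
  have z: "z \<in> open_segment a b" using ab by (simp add: z_def)
  have zs: "side a b z = 0" using z side_segment by (auto simp: open_segment_def)
  have kl: "keeps_left K a b z" using d z by (simp add: darts_def)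
  have cz: "centroid {a, b} = z" using ab by (simp add: centroid_def z_def midpoint_def)
  have tR: "((\<lambda>t. z + t *\<^sub>R (\<i> * (a - b))) \<longlongrightarrow> z) (at_right 0)"
    and tL: "((\<lambda>t. z + t *\<^sub>R (\<i> * (b - a))) \<longlongrightarrow> z) (at_right 0)"
    by (rule tendsto_side_shift)+
  have pos: "\<forall>\<^sub>F t::real in at_right 0. t > 0" by (simp add: eventually_at_right_less)
  have out: "\<forall>\<^sub>F t in at_right 0. z + t *\<^sub>R (\<i> * (a - b)) \<notin> K"
    using eventually_compose_filterlim[OF kl[unfolded keeps_left_def] tR] pos
    by eventually_elim (use ab zs in \<open>auto simp: side_shift side_swap[of a b]\<close>)
  have inn: "\<forall>\<^sub>F t in at_right 0. z + t *\<^sub>R (\<i> * (b - a)) \<in> K"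
    using eventually_compose_filterlim[OF kl[unfolded keeps_left_def] tL] pos
    by eventually_elim (use ab in \<open>auto simp: side_shift zs\<close>)
  show ?thesis unfolding area_normal_def cz
  proof (rule the_equality)
    have "- (\<i> * (b - a)) \<bullet> (b - a) = 0" by (simp add: inner_complex_def algebra_simps)
    moreover have "norm (- (\<i> * (b - a))) = dist a b" by (simp add: norm_mult dist_norm norm_minus_commute)
    ultimately show "(\<forall>c d. {a, b} = {c, d} \<longrightarrow> - (\<i> * (b - a)) \<bullet> (d - c) = 0 \<and> norm (- (\<i> * (b - a))) = dist c d) \<and>
      (\<forall>\<^sub>F t in at_right 0. z + t *\<^sub>R - (\<i> * (b - a)) \<notin> K)"
      using out by (auto simp: doubleton_eq_iff dist_commute algebra_simps inner_diff_right)
  next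
    fix S assume S: "(\<forall>c d. {a, b} = {c, d} \<longrightarrow> S \<bullet> (d - c) = 0 \<and> norm S = dist c d) \<and>
      (\<forall>\<^sub>F t in at_right 0. z + t *\<^sub>R S \<notin> K)"
    then have S1: "S \<bullet> (b - a) = 0" "norm S = norm (b - a)" by (auto simp: dist_norm norm_minus_commute)
    define q where "q = S / (b - a)"
    have q: "S = q * (b - a)" using ab by (simp add: q_def)
    have nq: "norm q = 1" using S1(2) ab by (simp add: q norm_mult)
    have "Re q * (norm (b - a))\<^sup>2 = 0"
      using S1(1) unfolding q inner_mult_self .
    then have "Re q = 0" using ab by simp
    with nq have "\<bar>Im q\<bar> = 1" by (simp add: cmod_def)
    then have "q = \<i> \<or> q = - \<i>" using \<open>Re q = 0\<close> by (auto simp: complex_eq_iff abs_if split: if_splits)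
    moreover have "q \<noteq> \<i>"
    proof
      assume "q = \<i>"
      then have "\<forall>\<^sub>F t in at_right 0. z + t *\<^sub>R (\<i> * (b - a)) \<notin> K" using S q by simp
      with inn have "\<forall>\<^sub>F t in at_right (0::real). False" by eventually_elim simp
      then show False by (simp add: trivial_limit_at_right_real)
    qed
    ultimately show "S = - (\<i> * (b - a))" using q by simp
  qed
qed

end

section \<open>Passing from one face to the next at a corner\<close>

lemma eventually_nhds_open_segment:
  fixes p r :: complex
  assumes "\<forall>\<^sub>F w in nhds p. P w" "p \<noteq> r"
  shows "\<exists>w \<in> open_segment p r. P w"
proof -
  have "((\<lambda>s::real. (1 - s) *\<^sub>R p + s *\<^sub>R r) \<longlongrightarrow> p) (at_right 0)"
    by (rule tendsto_eq_intros refl | simp)+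
  with assms(1) have "\<forall>\<^sub>F s in at_right 0. P ((1 - s) *\<^sub>R p + s *\<^sub>R r)"
    by (rule eventually_compose_filterlim)
  moreover have "\<forall>\<^sub>F s::real in at_right 0. s \<in> {0<..<1}"
    by (rule eventually_at_right_real) simp
  ultimately have "\<forall>\<^sub>F s in at_right 0. P ((1 - s) *\<^sub>R p + s *\<^sub>R r) \<and> 0 < s \<and> s < 1"
    by eventually_elim simp
  then obtain s where "P ((1 - s) *\<^sub>R p + s *\<^sub>R r)" "0 < s" "s < 1"
    using eventually_happens[of _ "at_right (0::real)"] by (auto simp: trivial_limit_at_right_real)
  then show ?thesis using assms(2)
    by (intro bexI[of _ "(1 - s) *\<^sub>R p + s *\<^sub>R r"]) (auto simp: in_segment)
qed

context polygonal_region
begin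

text \<open>
  A short segment cutting off the corner \<open>a\<close> misses the frontier, hence lies inside or outside
  \<open>K\<close> as a whole, while its ends show on which side of the two faces \<open>K\<close> lies.
\<close>

lemma dart_corner:
  assumes d: "(b, a) \<in> darts" and f: "{a, c} \<in> F" and nc: "\<not> collinear {a, b, c}"
    and only: "\<And>f. f \<in> F \<Longrightarrow> a \<in> f \<Longrightarrow> f = {a, b} \<or> f = {a, c}"
  shows "(a, c) \<in> darts"
proof (rule ccontr)
  assume "(a, c) \<notin> darts"
  then have d': "(c, a) \<in> darts" using darts_cases f by blast
  have fb: "{a, b} \<in> F" using darts_face[OF d] by (simp add: insert_commute)
  define \<sigma> where "\<sigma> = side a b c"
  have \<sigma>: "\<sigma> \<noteq> 0" using side_eq_0_imp_collinear nc by (auto simp: \<sigma>_def)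
  have neq: "a \<noteq> b" "a \<noteq> c" "b \<noteq> c" using nc by (auto simp: insert_commute)
  have "a \<notin> convex hull g" if "g \<in> F - {{a, b}, {a, c}}" for g
  proof
    assume "a \<in> convex hull g"
    moreover have "a \<in> convex hull {a, b}" by (simp add: hull_inc)
    ultimately have "a \<in> g" using face_Int[OF fb, of g] that by blast
    then show False using only that by blast
  qed
  then have "a \<in> - (\<Union>g \<in> F - {{a, b}, {a, c}}. convex hull g)" by blast
  then obtain e where e: "e > 0" "ball a e \<subseteq> - (\<Union>g \<in> F - {{a, b}, {a, c}}. convex hull g)"
    using open_avoid_faces[of "F - {{a, b}, {a, c}}"] by (meson Diff_subset open_contains_ball)
  have "((\<lambda>t. a + t *\<^sub>R (x - a)) \<longlongrightarrow> a) (at_right 0)" for x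
    by (rule tendsto_eq_intros refl | simp)+
  then have "\<forall>\<^sub>F t in at_right 0. a + t *\<^sub>R (x - a) \<in> ball a e" for x
    by (rule topological_tendstoD) (use e(1) in auto)
  then have "\<forall>\<^sub>F t in at_right 0. a + t *\<^sub>R (b - a) \<in> ball a e \<and> a + t *\<^sub>R (c - a) \<in> ball a e \<and> t \<in> {0<..<1}"
    by (intro eventually_conj eventually_at_right_real) simp_all
  then obtain \<epsilon> where \<epsilon>: "a + \<epsilon> *\<^sub>R (b - a) \<in> ball a e" "a + \<epsilon> *\<^sub>R (c - a) \<in> ball a e" "0 < \<epsilon>" "\<epsilon> < 1"
    using eventually_happens[of _ "at_right (0::real)"] by (auto simp: trivial_limit_at_right_real)
  define p where "p = a + \<epsilon> *\<^sub>R (b - a)"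
  define r where "r = a + \<epsilon> *\<^sub>R (c - a)"
  have pr: "p \<noteq> r" using \<epsilon> neq by (simp add: p_def r_def)
  have p: "p \<in> open_segment a b" and r: "r \<in> open_segment a c"
    using \<epsilon> neq by (auto simp: p_def r_def in_segment intro!: exI[of _ \<epsilon>] simp: algebra_simps)
  define S where "S = open_segment p r"
  \<comment> \<open>Opposite signs: the cut-off segment runs inside the angle at \<open>a\<close>,
    on the \<open>c\<close>-side of one face and on the \<open>b\<close>-side of the other.\<close>
  have S_side: "\<exists>s>0. side a b w = s * \<sigma> \<and> (\<exists>s>0. side a c w = - s * \<sigma>)" if w: "w \<in> S" for w
  proof -
    obtain s where s: "0 < s" "s < 1" "w = (1 - s) *\<^sub>R p + s *\<^sub>R r"
      using w by (auto simp: S_def in_segment)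
    have self: "side a x a = 0" "side a x x = 0" for x by (simp_all add: side_def inner_complex_def algebra_simps)
    have "side a b w = (s * \<epsilon>) * \<sigma>" "side a c w = - ((1 - s) * \<epsilon>) * \<sigma>"
      unfolding s(3) side_convex_comb p_def r_def side_affine self \<sigma>_def side_swap_last[of a c b]
      by simp_all
    then show ?thesis using s \<epsilon> by (metis diff_gt_0_iff_gt mult_pos_pos)
  qed
  have "S \<subseteq> ball a e"
    unfolding S_def using \<epsilon>(1,2) convex_ball[of a e] by (simp add: convex_contains_open_segment p_def r_def)
  then have "S \<inter> frontier K = {}"
  proof -
    assume SB: "S \<subseteq> ball a e"
    have "w \<notin> frontier K" if w: "w \<in> S" for w
    proof
      assume "w \<in> frontier K"
      then obtain g where g: "g \<in> F" "w \<in> convex hull g" by (auto simp: frontier_eq)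
      then have "g = {a, b} \<or> g = {a, c}" using e(2) SB w by blast
      then have "side a b w = 0 \<or> side a c w = 0"
        using g(2) side_segment by (auto simp: segment_convex_hull)
      then show False using S_side[OF w] \<sigma> by auto
    qed
    then show ?thesis by blast
  qed
  then have S: "S \<subseteq> K \<or> S \<inter> K = {}"
    using connected_Int_frontier[OF convex_connected[OF convex_open_segment], of p r K]
    by (auto simp: S_def)
  have klp: "keeps_left K b a p" using d p by (auto simp: darts_def open_segment_commute)
  have klr: "keeps_left K c a r" using d' r by (auto simp: darts_def open_segment_commute)
  \<comment> \<open>\<open>w\<close> is taken close to the end \<open>p\<close>, \<open>w'\<close>
    close to the end \<open>r\<close>. Two darts both leading into \<open>a\<close> would put
    exactly one of them into \<open>K\<close>.\<close>
  obtain w where w: "w \<in> S" "(side b a w > 0 \<longrightarrow> w \<in> K) \<and> (side b a w < 0 \<longrightarrow> w \<notin> K)"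
    using eventually_nhds_open_segment[OF klp[unfolded keeps_left_def] pr] S_def by blast
  obtain w' where w': "w' \<in> S" "(side c a w' > 0 \<longrightarrow> w' \<in> K) \<and> (side c a w' < 0 \<longrightarrow> w' \<notin> K)"
    using eventually_nhds_open_segment[OF klr[unfolded keeps_left_def] pr[symmetric]]
    unfolding S_def open_segment_commute[of p r] by blast
  obtain s s' where s: "s > 0" "side b a w = - s * \<sigma>" "s' > 0" "side c a w' = s' * \<sigma>"
    using S_side[OF w(1)] S_side[OF w'(1)] side_swap[of b a w] side_swap[of c a w'] by fastforce
  show False
  proof (cases "\<sigma> > 0")
    case True
    then have "side b a w < 0" "side c a w' > 0" using s by (simp_all add: mult_pos_pos)
    then show False using w w' S by blast
  next
    case False
    then have "\<sigma> < 0" using \<sigma> by simp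
    then have "side b a w > 0" "side c a w' < 0" using s by (simp_all add: mult_pos_neg)
    then show False using w w' S by blast
  qed
qed

end

section \<open>The directed cycle of a cell\<close>

text \<open>A relation instead of a list: it has no starting point, and it can be compared with its
  visible part by inclusion and difference. Asymmetry excludes loops and cycles of length two;
  reachability makes it a single orbit. The empty relation qualifies, hence the separate
  nonemptiness conditions later on.\<close>

definition directed_cycle :: "('a \<times> 'a) set \<Rightarrow> bool" where
  "directed_cycle D \<longleftrightarrow> finite D \<and> single_valued D \<and> single_valued (D\<inverse>) \<and> Domain D = Range D \<and>
     (\<forall>x y. (x, y) \<in> D \<longrightarrow> (y, x) \<notin> D) \<and> (\<forall>x \<in> Field D. \<forall>y \<in> Field D. (x, y) \<in> D\<^sup>*)"

lemma directed_cycle_converse: "directed_cycle D \<Longrightarrow> directed_cycle (D\<inverse>)"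
  unfolding directed_cycle_def by (auto simp: rtrancl_converse)

definition cyclic_pairs :: "'a list \<Rightarrow> ('a \<times> 'a) set" where
  "cyclic_pairs vs = (\<lambda>k. (vs ! k, vs ! (Suc k mod length vs))) ` {..<length vs}"

lemma directed_cycle_cyclic_pairs:
  assumes "3 \<le> length vs" "distinct vs"
  shows "directed_cycle (cyclic_pairs vs)"
proof -
  let ?n = "length vs"
  let ?D = "cyclic_pairs vs"
  have n: "?n > 0" using assms by auto
  have ix: "vs ! i = vs ! j \<longleftrightarrow> i = j" if "i < ?n" "j < ?n" for i j
    using that assms nth_eq_iff_index_eq by blast
  have sm: "Suc k mod ?n < ?n" for k using n by simp
  have si: "i = j" if "Suc i mod ?n = Suc j mod ?n" "i < ?n" "j < ?n" for i j
    using that by (auto simp: mod_Suc split: if_splits)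
  have mem: "(vs ! k, vs ! (Suc k mod ?n)) \<in> ?D" if "k < ?n" for k
    using that by (auto simp: cyclic_pairs_def)
  have dom: "Domain ?D = set vs"
    by (auto simp: cyclic_pairs_def Domain_fst image_image in_set_conv_nth)
  have ran: "Range ?D = set vs"
  proof
    show "Range ?D \<subseteq> set vs" using n by (auto simp: cyclic_pairs_def)
    show "set vs \<subseteq> Range ?D"
    proof
      fix x assume "x \<in> set vs"
      then obtain j where j: "j < ?n" "x = vs ! j" by (auto simp: in_set_conv_nth)
      show "x \<in> Range ?D"
      proof (cases j)
        case 0
        then have "(vs ! (?n - 1), x) \<in> ?D" using mem[of "?n - 1"] n j by simp
        then show ?thesis by blast
      next
        case (Suc i)
        then have "(vs ! i, x) \<in> ?D" using mem[of i] j by simp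
        then show ?thesis by blast
      qed
    qed
  qed
  have up: "(vs ! i, vs ! (i + d)) \<in> ?D\<^sup>*" if "i + d < ?n" for i d
    using that
  proof (induction d)
    case (Suc d)
    then have "(vs ! (i + d), vs ! (i + Suc d)) \<in> ?D" using mem[of "i + d"] by simp
    with Suc show ?case by (auto intro: rtrancl_into_rtrancl)
  qed simp
  \<comment> \<open>The path runs up to the last index, wraps around to \<open>0\<close> and runs up
    again, so that the order of \<open>i\<close> and \<open>j\<close> does not matter.\<close>
  have conn: "(vs ! i, vs ! j) \<in> ?D\<^sup>*" if "i < ?n" "j < ?n" for i j
  proof -
    have "(vs ! i, vs ! (?n - 1)) \<in> ?D\<^sup>*" using up[of i "?n - 1 - i"] that by simp
    moreover have "(vs ! (?n - 1), vs ! 0) \<in> ?D" using mem[of "?n - 1"] n by simp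
    moreover have "(vs ! 0, vs ! j) \<in> ?D\<^sup>*" using up[of 0 j] that by simp
    ultimately show ?thesis by (meson rtrancl_into_rtrancl rtrancl_trans)
  qed
  show ?thesis unfolding directed_cycle_def
  proof (intro conjI allI impI ballI)
    show "finite ?D" by (simp add: cyclic_pairs_def)
    show "single_valued ?D" by (auto simp: cyclic_pairs_def single_valued_def ix)
    show "single_valued (?D\<inverse>)"
      by (auto simp: cyclic_pairs_def single_valued_def ix sm dest: si)
    show "Domain ?D = Range ?D" by (simp add: dom ran)
  next
    fix x y assume "(x, y) \<in> ?D"
    then obtain i where i: "i < ?n" "x = vs ! i" "y = vs ! (Suc i mod ?n)" by (auto simp: cyclic_pairs_def)
    show "(y, x) \<notin> ?D"
    proof
      assume "(y, x) \<in> ?D"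
      then obtain j where j: "j < ?n" "y = vs ! j" "x = vs ! (Suc j mod ?n)" by (auto simp: cyclic_pairs_def)
      have "j = Suc i mod ?n" using ix[OF j(1) sm[of i]] i j by simp
      moreover have "Suc j mod ?n = i" using ix[OF sm[of j] i(1)] i j by simp
      ultimately have "Suc (Suc i mod ?n) mod ?n = i" by simp
      \<comment> \<open>Two steps around a cycle of length at least three never return to the start;
        length two would fail here.\<close>
      then show False using i(1) assms(1) by (auto simp: mod_Suc split: if_splits)
    qed
  next
    fix x y assume "x \<in> Field ?D" "y \<in> Field ?D"
    then show "(x, y) \<in> ?D\<^sup>*" using conn by (auto simp: Field_def dom ran in_set_conv_nth)
  qed
qed

locale polygonal_cell = polygonal_region +
  fixes vs :: "complex list"
  assumes length_vs: "3 \<le> length vs" and distinct_vs: "distinct vs"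
    and sides: "F = polygon_sides vs"
    and corners: "{a, b} \<in> F \<Longrightarrow> {b, c} \<in> F \<Longrightarrow> a \<noteq> c \<Longrightarrow> \<not> collinear {a, b, c}"
begin

text \<open>As the list is distinct, exactly two faces of the cell meet at the node, and they are
  not collinear, so \<open>dart_corner\<close> turns the incoming dart into an outgoing one.\<close>

lemma dart_step:
  assumes k: "k < length vs" and d: "(vs ! k, vs ! (Suc k mod length vs)) \<in> darts"
  shows "(vs ! (Suc k mod length vs), vs ! (Suc (Suc k mod length vs) mod length vs)) \<in> darts"
proof -
  let ?n = "length vs"
  define k' where "k' = Suc k mod ?n"
  define k'' where "k'' = Suc k' mod ?n"
  have lt: "k' < ?n" "k'' < ?n" using length_vs by (auto simp: k'_def k''_def intro!: mod_less_divisor)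
  have ix: "vs ! i = vs ! j \<longleftrightarrow> i = j" if "i < ?n" "j < ?n" for i j
    using that distinct_vs nth_eq_iff_index_eq by blast
  have "k \<noteq> k''" using length_vs k by (auto simp: k'_def k''_def mod_Suc split: if_splits)
  then have ne: "vs ! k \<noteq> vs ! k''" using ix k lt by blast
  have f1: "{vs ! k, vs ! k'} \<in> F" and f2: "{vs ! k', vs ! k''} \<in> F"
    using k lt by (auto simp: sides polygon_sides_def k'_def k''_def)
  have "(vs ! k', vs ! k'') \<in> darts"
  proof (rule dart_corner[of "vs ! k"])
    show "\<not> collinear {vs ! k', vs ! k, vs ! k''}"
      using corners[OF f1 f2 ne] by (simp add: insert_commute)
    fix f assume "f \<in> F" "vs ! k' \<in> f"
    then obtain j where j: "j < ?n" "f = {vs ! j, vs ! (Suc j mod ?n)}" "vs ! k' \<in> f"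
      by (auto simp: sides polygon_sides_def)
    have "Suc j mod ?n < ?n" using length_vs by (auto intro!: mod_less_divisor)
    with j have "k' = j \<or> k' = Suc j mod ?n" using ix lt by auto
    moreover have "j = k" if "k' = Suc j mod ?n"
      using that j k by (auto simp: k'_def mod_Suc split: if_splits)
    ultimately show "f = {vs ! k', vs ! k} \<or> f = {vs ! k', vs ! k''}"
      using j(2) unfolding k'_def k''_def by (auto simp: insert_commute)
  qed (use d f2 k'_def in auto)
  then show ?thesis by (simp add: k'_def k''_def)
qed

text \<open>The list may run around the cell either way. By \<open>dart_step\<close> one face
  traversed in the direction of the list forces all of them; if there is none, every face is
  traversed backwards.\<close>

lemma darts_eq: "darts = cyclic_pairs vs \<or> darts = (cyclic_pairs vs)\<inverse>"
proof -
  let ?n = "length vs"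
  let ?P = "\<lambda>k. (vs ! k, vs ! (Suc k mod ?n)) \<in> darts"
  have up: "?P (k + d)" if "?P k" "k + d < ?n" for k d
    using that(2)
  proof (induction d)
    case (Suc d)
    then show ?case using dart_step[of "k + d"] by simp
  qed (use that in simp)
  have all: "?P j" if "?P k" "k < ?n" "j < ?n" for j k
  proof -
    have "?P (?n - 1)" using up[of k "?n - 1 - k"] that by simp
    then have "?P 0" using dart_step[of "?n - 1"] length_vs by (cases ?n) auto
    then show ?thesis using up[of 0 j] that by simp
  qed
  have face: "(x, y) \<in> cyclic_pairs vs \<or> (y, x) \<in> cyclic_pairs vs" if "(x, y) \<in> darts" for x y
    using darts_face[OF that] by (auto simp: sides polygon_sides_def cyclic_pairs_def doubleton_eq_iff)
  have cases: "?P k \<or> (vs ! (Suc k mod ?n), vs ! k) \<in> darts" if "k < ?n" for k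
    using that by (intro darts_cases) (auto simp: sides polygon_sides_def)
  show ?thesis
  proof (cases "\<exists>k < ?n. ?P k")
    case True
    then have "cyclic_pairs vs \<subseteq> darts" using all by (auto simp: cyclic_pairs_def)
    moreover have "darts \<subseteq> cyclic_pairs vs"
      using calculation face darts_asym by (intro subrelI) blast
    ultimately have "darts = cyclic_pairs vs" by simp
    then show ?thesis ..
  next
    case False
    then have "(cyclic_pairs vs)\<inverse> \<subseteq> darts" using cases by (auto simp: cyclic_pairs_def)
    moreover have "darts \<subseteq> (cyclic_pairs vs)\<inverse>"
      using calculation face darts_asym by (intro subrelI) blast
    ultimately have "darts = (cyclic_pairs vs)\<inverse>" by simp
    then show ?thesis ..
  qed
qed

lemma directed_cycle_darts: "directed_cycle darts"
  using darts_eq directed_cycle_cyclic_pairs[OF length_vs distinct_vs] directed_cycle_converse by metis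

lemma darts_nonempty: "darts \<noteq> {}"
proof -
  have "{vs ! 0, vs ! (Suc 0 mod length vs)} \<in> F"
    using length_vs unfolding sides polygon_sides_def by fastforce
  then show ?thesis using darts_cases by blast
qed

lemma Field_darts: "Field darts = \<Union> F"
proof (intro equalityI subsetI)
  fix x assume "x \<in> Field darts"
  then obtain y where "(x, y) \<in> darts \<or> (y, x) \<in> darts" by (auto simp: Field_def)
  then have "{x, y} \<in> F" using darts_face by (metis insert_commute)
  then show "x \<in> \<Union> F" by blast
next
  fix x assume "x \<in> \<Union> F"
  then obtain f where f: "f \<in> F" "x \<in> f" by blast
  then obtain p q where pq: "f = {p, q}" using card_face[of f] unfolding card_2_iff by blast
  then have "(p, q) \<in> darts \<or> (q, p) \<in> darts" using darts_cases[of p q] f by blast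
  then show "x \<in> Field darts" using f pq by (blast intro: FieldI1 FieldI2)
qed

end

section \<open>The area of a cell\<close>

text \<open>Punctured neighbourhoods allow exceptional values at isolated points, but the constant
  must be the same on both sides of them. The function of these limit values is then locally
  constant on the connected line.\<close>

lemma eventually_at_const:
  fixes g :: "real \<Rightarrow> 'a"
  assumes "\<And>y. \<exists>c. \<forall>\<^sub>F z in at y. g z = c"
  obtains c where "\<And>y. \<forall>\<^sub>F z in at y. g z = c"
proof -
  obtain G where G: "\<And>y. \<forall>\<^sub>F z in at y. g z = G y" using assms by metis
  have uniq: "c = G y" if "\<forall>\<^sub>F z in at y. g z = c" for c y
  proof -
    have "\<forall>\<^sub>F z in at y. c = G y" using that G[of y] by eventually_elim simp
    then show ?thesis using eventually_happens[of "\<lambda>_. c = G y" "at y"] by simp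
  qed
  have "\<forall>\<^sub>F z in at y. G y = G z" for y
  proof -
    have "\<forall>\<^sub>F z in at y. \<forall>\<^sub>F w in at z. g w = G y"
    proof -
      obtain S where S: "open S" "y \<in> S" "\<And>z. z \<in> S \<Longrightarrow> z \<noteq> y \<Longrightarrow> g z = G y"
        using G[of y] by (auto simp: eventually_at_topological)
      have "\<forall>\<^sub>F w in at z. g w = G y" if "z \<in> S" "z \<noteq> y" for z
        using S that unfolding eventually_at_topological by (intro exI[of _ "S - {y}"]) auto
      then show ?thesis using S(1,2) unfolding eventually_at_topological by blast
    qed
    then show ?thesis by (rule eventually_mono) (rule uniq)
  qed
  then have "G y = G 0" for y
    by (intro connected_local_const[of UNIV]) auto
  then show ?thesis using G that[of "G 0"] by metis
qed

lemma eventually_of_bool_less_const: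
  fixes y h :: real
  assumes "y \<noteq> h"
  shows "\<forall>\<^sub>F z in nhds y. (of_bool (z < h) :: real) = of_bool (y < h)"
proof (cases "y < h")
  case True
  then show ?thesis using eventually_nhds_in_open[of "{..<h}" y] by (auto elim!: eventually_mono)
next
  case False
  then show ?thesis using assms eventually_nhds_in_open[of "{h<..}" y] by (auto elim!: eventually_mono)
qed

text \<open>With the region on its left, a dart leading to the left (sign 1) has the region beneath
  it, one leading to the right (sign -1) has it above. The intervals are closed, so a vertical dart
  gets 0 everywhere, even at its own abscissa.\<close>

definition dart_sign :: "real \<Rightarrow> complex \<times> complex \<Rightarrow> real" where
  "dart_sign x e = indicator {Re (snd e)..Re (fst e)} x - indicator {Re (fst e)..Re (snd e)} x"

text \<open>Meaningless for vertical darts, for which \<open>dart_sign\<close> vanishes.\<close>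

definition dart_height :: "real \<Rightarrow> complex \<times> complex \<Rightarrow> real" where
  "dart_height x e = Im (fst e) + (x - Re (fst e)) * ((Im (snd e) - Im (fst e)) / (Re (snd e) - Re (fst e)))"

lemma dart_sign_neq_0:
  assumes "dart_sign x e \<noteq> 0" "Re (fst e) \<noteq> x" "Re (snd e) \<noteq> x"
  shows "Complex x (dart_height x e) \<in> open_segment (fst e) (snd e)"
proof -
  obtain a b where e: "e = (a, b)" by (cases e)
  have ne: "Re a \<noteq> Re b" and bt: "(Re a < x \<and> x < Re b) \<or> (Re b < x \<and> x < Re a)"
    using assms by (auto simp: e dart_sign_def indicator_def split: if_splits)
  define u where "u = (x - Re a) / (Re b - Re a)"
  have "0 < u" "u < 1" using bt ne by (auto simp: u_def divide_simps)
  moreover have "Complex x (dart_height x e) = (1 - u) *\<^sub>R a + u *\<^sub>R b"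
  proof -
    have "u * (Re b - Re a) = x - Re a" using ne by (simp add: u_def)
    then have "x = (1 - u) * Re a + u * Re b" by (simp add: algebra_simps)
    moreover have "dart_height x e = Im a + u * (Im b - Im a)" by (simp add: e dart_height_def u_def)
    ultimately show ?thesis by (simp add: complex_eq_iff algebra_simps)
  qed
  ultimately show ?thesis using ne by (auto simp: in_segment e)
qed

lemma dart_segment_point:
  assumes "Complex x y \<in> closed_segment a b" "Re a \<noteq> x" "Re b \<noteq> x"
  shows "dart_sign x (a, b) = (if Re b < Re a then 1 else - 1)" "Re a \<noteq> Re b" "dart_height x (a, b) = y"
    "Complex x y \<in> open_segment a b"
proof -
  obtain u where u: "0 \<le> u" "u \<le> 1" "x = (1 - u) * Re a + u * Re b" "y = (1 - u) * Im a + u * Im b"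
    using assms(1) by (auto simp: in_segment complex_eq_iff)
  show ne: "Re a \<noteq> Re b" using u assms(2) by (auto simp: algebra_simps)
  have x: "x - Re a = u * (Re b - Re a)" "Re b - x = (1 - u) * (Re b - Re a)" by (simp_all add: u algebra_simps)
  have "0 < u" "u < 1" using u assms by (auto simp: less_le)
  then have bt: "(Re a < x \<and> x < Re b \<and> Re a < Re b) \<or> (Re b < x \<and> x < Re a \<and> Re b < Re a)"
    using x ne by (smt (verit) mult_pos_pos mult_pos_neg)
  then show "dart_sign x (a, b) = (if Re b < Re a then 1 else - 1)"
    by (auto simp: dart_sign_def indicator_def)
  have "(x - Re a) * ((Im b - Im a) / (Re b - Re a)) = u * (Im b - Im a)" using ne by (simp add: x(1))
  then show "dart_height x (a, b) = y" by (simp add: dart_height_def u(4) algebra_simps)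
  show "Complex x y \<in> open_segment a b" using assms by (auto simp: open_segment_def)
qed

section \<open>Vertical slices of a region\<close>

context polygonal_region
begin

lemma finite_darts: "finite darts"
proof -
  have "finite (\<Union>F)" using finite_faces card_face by (metis card.infinite finite_Union zero_neq_numeral)
  moreover have "darts \<subseteq> \<Union>F \<times> \<Union>F" using darts_face by fast
  ultimately show ?thesis by (meson finite_SigmaI finite_subset)
qed

lemma dart_point_frontier:
  assumes "e \<in> darts" "dart_sign x e \<noteq> 0" "x \<notin> Re ` \<Union>F"
  shows "Complex x (dart_height x e) \<in> frontier K"
    and "Complex x (dart_height x e) \<in> open_segment (fst e) (snd e)"
proof -
  have f: "{fst e, snd e} \<in> F" using darts_face[of "fst e" "snd e"] assms(1) by simp
  then show "Complex x (dart_height x e) \<in> open_segment (fst e) (snd e)"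
    using assms by (intro dart_sign_neq_0) auto
  then show "Complex x (dart_height x e) \<in> frontier K"
    using f by (auto simp: frontier_eq segment_convex_hull open_segment_def)
qed

lemma frontier_dart:
  assumes "Complex x y \<in> frontier K" "x \<notin> Re ` \<Union>F"
  obtains a b where "(a, b) \<in> darts" "Complex x y \<in> closed_segment a b"
    "Re a \<noteq> x" "Re b \<noteq> x"
proof -
  obtain f where f: "f \<in> F" "Complex x y \<in> convex hull f" using assms(1) by (auto simp: frontier_eq)
  obtain p q where pq: "f = {p, q}" using card_face[OF f(1)] unfolding card_2_iff by blast
  have "Complex x y \<in> closed_segment p q" using f pq by (simp add: segment_convex_hull)
  moreover have "Re p \<noteq> x" "Re q \<noteq> x" using assms(2) f pq by auto
  moreover have "(p, q) \<in> darts \<or> (q, p) \<in> darts" using darts_cases f pq by blast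
  ultimately show ?thesis using that by (metis closed_segment_commute)
qed

text \<open>
  Along a vertical line that avoids the nodes, the jumps of both sides at the faces cancel, so that
  their difference is constant, and it vanishes far up.
\<close>

lemma slice_indicator:
  assumes x: "x \<notin> Re ` \<Union>F" and y: "\<And>e. e \<in> darts \<Longrightarrow> dart_sign x e \<noteq> 0 \<Longrightarrow> y \<noteq> dart_height x e"
  shows "indicator K (Complex x y) = (\<Sum>e \<in> darts. dart_sign x e * of_bool (y < dart_height x e))"
proof -
  define T where "T e y = dart_sign x e * of_bool (y < dart_height x e)" for e y
  define g where "g y = indicator K (Complex x y) - (\<Sum>e \<in> darts. T e y)" for y
  have T_const: "\<forall>\<^sub>F z in nhds y. T e z = T e y" if "dart_sign x e \<noteq> 0 \<Longrightarrow> y \<noteq> dart_height x e" for e y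
  proof (cases "dart_sign x e = 0")
    case False
    then show ?thesis using eventually_of_bool_less_const[OF that[OF False]]
      by (rule_tac eventually_mono) (auto simp: T_def)
  qed (simp add: T_def)
  have sum_const: "\<forall>\<^sub>F z in nhds y. (\<Sum>e \<in> D. T e z) = (\<Sum>e \<in> D. T e y)"
    if "D \<subseteq> darts" "\<And>e. e \<in> D \<Longrightarrow> dart_sign x e \<noteq> 0 \<Longrightarrow> y \<noteq> dart_height x e" for D y
  proof -
    have "finite D" using that finite_darts finite_subset by blast
    then have "\<forall>\<^sub>F z in nhds y. \<forall>e \<in> D. T e z = T e y"
      using that T_const by (intro eventually_ball_finite) auto
    then show ?thesis by eventually_elim (rule sum.cong, auto)
  qed
  have tend: "((\<lambda>z. Complex x z) \<longlongrightarrow> Complex x y) (nhds y)" for y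
    by (rule tendsto_eq_intros filterlim_ident refl)+
  have off: "\<forall>\<^sub>F z in nhds y. g z = g y" if "Complex x y \<notin> frontier K" for y
  proof -
    have "y \<noteq> dart_height x e" if "e \<in> darts" "dart_sign x e \<noteq> 0" for e
      using dart_point_frontier(1)[OF that x] \<open>Complex x y \<notin> frontier K\<close> by auto
    then have 1: "\<forall>\<^sub>F z in nhds y. (\<Sum>e \<in> darts. T e z) = (\<Sum>e \<in> darts. T e y)"
      by (intro sum_const) auto
    have "Complex x y \<in> interior K \<or> Complex x y \<in> - closure K"
      using that by (auto simp: frontier_def)
    then have "\<forall>\<^sub>F w in nhds (Complex x y). w \<in> K \<longleftrightarrow> Complex x y \<in> K"
    proof
      assume "Complex x y \<in> interior K"
      then have "\<forall>\<^sub>F w in nhds (Complex x y). w \<in> interior K" by (intro eventually_nhds_in_open) auto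
      then show ?thesis using \<open>Complex x y \<in> interior K\<close> interior_subset
        by (auto elim!: eventually_mono)
    next
      assume A: "Complex x y \<in> - closure K"
      then have "\<forall>\<^sub>F w in nhds (Complex x y). w \<in> - closure K" by (intro eventually_nhds_in_open) auto
      then show ?thesis using A closure_subset by (auto elim!: eventually_mono)
    qed
    then have "\<forall>\<^sub>F z in nhds y. Complex x z \<in> K \<longleftrightarrow> Complex x y \<in> K"
      using tend by (rule eventually_compose_filterlim)
    with 1 show ?thesis by eventually_elim (auto simp: g_def indicator_def)
  qed
  have "\<exists>c. \<forall>\<^sub>F z in at y. g z = c" for y
  proof (cases "Complex x y \<in> frontier K")
    case False
    then show ?thesis using off[of y]
      by (intro exI[of _ "g y"]) (auto simp: eventually_at_filter elim: eventually_mono)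
  next
    case True
    then obtain a b where ab: "(a, b) \<in> darts" "Complex x y \<in> closed_segment a b" "Re a \<noteq> x" "Re b \<noteq> x"
      using frontier_dart x by blast
    note pt = dart_segment_point[OF ab(2-4)]
    have ab_face: "{a, b} \<in> F" using darts_face ab(1) .
    \<comment> \<open>Distinct faces meet only in nodes and the line avoids all nodes, so just one
      dart passes through a given frontier point.\<close>
    have others: "y \<noteq> dart_height x e" if e: "e \<in> darts - {(a, b)}" "dart_sign x e \<noteq> 0" for e
    proof
      assume h: "y = dart_height x e"
      obtain p q where pq: "e = (p, q)" by (cases e)
      have f: "{p, q} \<in> F" using e darts_face pq by blast
      have "{p, q} \<noteq> {a, b}" using e pq ab(1) darts_asym by (auto simp: doubleton_eq_iff)
      then have "convex hull {p, q} \<inter> convex hull {a, b} \<subseteq> {a, b}" using face_Int[OF f ab_face] by blast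
      moreover have "Complex x y \<in> convex hull {p, q}"
        using dart_point_frontier(2)[OF _ e(2) x] e(1) h pq
        by (auto simp: segment_convex_hull[symmetric] open_segment_def)
      ultimately have "Complex x y \<in> {a, b}" using ab(2) by (auto simp: segment_convex_hull)
      then show False using ab by auto
    qed
    then have 1: "\<forall>\<^sub>F z in nhds y. (\<Sum>e \<in> darts - {(a, b)}. T e z) = (\<Sum>e \<in> darts - {(a, b)}. T e y)"
      by (intro sum_const) auto
    have "keeps_left K a b (Complex x y)" using ab(1) pt(4) by (simp add: darts_def)
    then have 2: "\<forall>\<^sub>F z in nhds y. (side a b (Complex x z) > 0 \<longrightarrow> Complex x z \<in> K) \<and>
        (side a b (Complex x z) < 0 \<longrightarrow> Complex x z \<notin> K)"
      unfolding keeps_left_def using tend by (rule eventually_compose_filterlim)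
    have s0: "side a b (Complex x y) = 0" using side_segment ab(2) by blast
    have sz: "side a b (Complex x z) = (z - y) * (Re b - Re a)" for z
    proof -
      have "side a b (Complex x z) = side a b (Complex x y) + (z - y) * (Re b - Re a)"
        by (simp add: side_def inner_complex_def algebra_simps)
      then show ?thesis using s0 by simp
    qed
    \<comment> \<open>The two jumps at height \<open>y\<close>: for a dart leading left, indicator
      and summand both drop from 1 to 0; for one leading right, the indicator rises from 0 to 1 and
      the summand from -1 to 0. The difference stays 0, respectively 1.\<close>
    have "\<forall>\<^sub>F z in at y. g z = (if Re b < Re a then 0 else 1) - (\<Sum>e \<in> darts - {(a, b)}. T e y)"
      unfolding eventually_at_filter using 1 2
    proof eventually_elim
      case (elim z)
      have "g z = indicator K (Complex x z) - T (a, b) z - (\<Sum>e \<in> darts - {(a, b)}. T e z)"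
        unfolding g_def using sum.remove[OF finite_darts ab(1), of "\<lambda>e. T e z"] by simp
      moreover have "indicator K (Complex x z) - T (a, b) z = (if Re b < Re a then 0 else 1)" if "z \<noteq> y"
        using elim(2) that pt(1,2,3) unfolding sz T_def
        by (cases "z < y"; cases "Re b < Re a") (auto simp: indicator_def mult_pos_pos mult_neg_neg mult_pos_neg mult_neg_pos)
      ultimately show ?case using elim(1) by simp
    qed
    then show ?thesis by blast
  qed
  then obtain c where c: "\<And>y. \<forall>\<^sub>F z in at y. g z = c" using eventually_at_const by metis
  obtain R where R: "\<And>z. z \<in> K \<Longrightarrow> norm z \<le> R"
    using compact_imp_bounded[OF compact] by (auto simp: bounded_iff)
  obtain H where H: "\<And>e. e \<in> darts \<Longrightarrow> dart_height x e \<le> H"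
    using finite_darts by (metis finite_imageI imageI Max_ge)
  define Y where "Y = max R H"
  have "g z = 0" if "z > Y" for z
  proof -
    have "Complex x z \<notin> K"
      using R[of "Complex x z"] abs_Im_le_cmod[of "Complex x z"] that by (auto simp: Y_def)
    moreover have "T e z = 0" if "e \<in> darts" for e
      using H[OF that] \<open>z > Y\<close> by (auto simp: T_def Y_def)
    ultimately show ?thesis by (simp add: g_def)
  qed
  then have "\<forall>\<^sub>F z in at (Y + 1). g z = 0"
    using eventually_at_in_open'[of "{Y<..}" "Y + 1"] by (auto elim!: eventually_mono)
  with c[of "Y + 1"] have "\<forall>\<^sub>F z in at (Y + 1). c = 0" by eventually_elim simp
  then have c0: "c = 0" using eventually_happens[of "\<lambda>_. c = 0" "at (Y + 1)"] by simp
  \<comment> \<open>So far only punctured neighbourhoods are controlled; since \<open>y\<close> is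
    not the height of a dart, the constant is also the value at \<open>y\<close> itself.\<close>
  have "Complex x y \<notin> frontier K"
  proof
    assume "Complex x y \<in> frontier K"
    then obtain a b where ab: "(a, b) \<in> darts" "Complex x y \<in> closed_segment a b" "Re a \<noteq> x" "Re b \<noteq> x"
      using frontier_dart x by blast
    then show False using y[OF ab(1)] dart_segment_point[OF ab(2-4)] by (auto split: if_splits)
  qed
  then have "\<forall>\<^sub>F z in at y. g z = g y"
    using off[of y] by (auto simp: eventually_at_filter elim: eventually_mono)
  with c[of y] have "\<forall>\<^sub>F z in at y. g y = 0" by eventually_elim (simp add: c0)
  then have "g y = 0" using eventually_happens[of "\<lambda>_. g y = 0" "at y"] by simp
  then show ?thesis by (simp add: g_def T_def)
qed

end

text \<open>
  The signed area between the dart and the real axis, positive for a dart that leads to the left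
  above the axis.
\<close>

definition trapezoid :: "complex \<Rightarrow> complex \<Rightarrow> real" where
  "trapezoid a b = (Re a - Re b) * (Im a + Im b) / 2"


text \<open>Makes Fubini available on the complex plane. Lebesgue measure is characterised by its
  values on boxes, and boxes correspond to products of intervals.\<close>

lemma lborel_complex_eq_distr:
  "lborel = distr (lborel \<Otimes>\<^sub>M lborel) borel (\<lambda>(x, y). Complex x y)"
proof (rule lborel_eqI)
  have meas[measurable]: "(\<lambda>(x, y). Complex x y) \<in> borel_measurable (lborel \<Otimes>\<^sub>M lborel)"
    unfolding Complex_eq[abs_def] by measurable
  fix l u :: complex
  assume le: "\<And>b. b \<in> Basis \<Longrightarrow> l \<bullet> b \<le> u \<bullet> b"
  have "(\<lambda>(x, y). Complex x y) -` box l u \<inter> space (lborel \<Otimes>\<^sub>M lborel) = {Re l<..<Re u} \<times> {Im l<..<Im u}"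
    by (auto simp: box_def Basis_complex_def space_pair_measure)
  moreover have "Re l \<le> Re u" "Im l \<le> Im u" using le[of 1] le[of \<i>] by (simp_all add: Basis_complex_def)
  ultimately show "emeasure (distr (lborel \<Otimes>\<^sub>M lborel) borel (\<lambda>(x, y). Complex x y)) (box l u) = (\<Prod>b\<in>Basis. (u - l) \<bullet> b)"
    by (simp add: emeasure_distr lborel.emeasure_pair_measure_Times ennreal_mult Basis_complex_def)
qed simp

lemma integral_dart_slice:
  "has_bochner_integral lborel (\<lambda>x. dart_sign x (a, b) * dart_height x (a, b))
     (trapezoid a b)"
proof (cases "Re a = Re b")
  case True
  then show ?thesis by (simp add: dart_sign_def trapezoid_def has_bochner_integral_zero)
next
  case False
  define m where "m = (Im b - Im a) / (Re b - Re a)"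
  \<comment> \<open>An antiderivative of the height. The sign of the dart reverses the limits of
    integration where necessary, so \<open>P (Re a) - P (Re b)\<close> results in either
    direction.\<close>
  define P where "P x = Im a * x + (x - Re a)\<^sup>2 / 2 * m" for x
  have h: "dart_height x (a, b) = Im a + (x - Re a) * m" for x by (simp add: dart_height_def m_def)
  have D: "(P has_real_derivative dart_height x (a, b)) (at x)" for x
    unfolding P_def h by (auto intro!: derivative_eq_intros)
  have C: "isCont (\<lambda>x. dart_height x (a, b)) x" for x unfolding h by (intro continuous_intros)
  have "(Re b - Re a)\<^sup>2 * m = (Re b - Re a) * (Im b - Im a)"
    using False by (simp add: m_def power2_eq_square)
  then have PP: "P (Re a) - P (Re b) = trapezoid a b"
    by (simp add: P_def trapezoid_def) (simp add: algebra_simps)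
  show ?thesis
  proof (cases "Re a < Re b")
    case True
    have "has_bochner_integral lborel (\<lambda>x. dart_height x (a, b) * indicator {Re a..Re b} x) (P (Re b) - P (Re a))"
      using True by (intro has_bochner_integral_FTC_Icc_real D C) auto
    then have "has_bochner_integral lborel (\<lambda>x. - (dart_height x (a, b) * indicator {Re a..Re b} x)) (- (P (Re b) - P (Re a)))"
      by (rule has_bochner_integral_minus)
    moreover have "dart_sign x (a, b) = - indicator {Re a..Re b} x" for x
      using True by (auto simp: dart_sign_def)
    ultimately show ?thesis by (simp add: PP mult.commute)
  next
    case ge: False
    have "has_bochner_integral lborel (\<lambda>x. dart_height x (a, b) * indicator {Re b..Re a} x) (P (Re a) - P (Re b))"
      using ge by (intro has_bochner_integral_FTC_Icc_real D C) auto
    moreover have "dart_sign x (a, b) = indicator {Re b..Re a} x" for x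
      using ge False by (auto simp: dart_sign_def)
    ultimately show ?thesis by (simp add: PP mult.commute)
  qed
qed

section \<open>The shoelace formula by Fubini\<close>

context polygonal_region
begin

text \<open>This is \<open>slice_indicator\<close> integrated over \<open>y\<close>. The half-lines
  below the darts have infinite length and are cut off at \<open>- R\<close>, below the region; the
  resulting multiples of \<open>R\<close> cancel because the signs sum to 0.\<close>

lemma slice_integral:
  assumes x: "x \<notin> Re ` \<Union>F"
  shows "(\<integral>y. indicator K (Complex x y) \<partial>lborel) = (\<Sum>e \<in> darts. dart_sign x e * dart_height x e)"
proof -
  obtain R where R: "\<And>z. z \<in> K \<Longrightarrow> norm z \<le> R"
    using compact_imp_bounded[OF compact] by (auto simp: bounded_iff)
  have in_R: "\<bar>y\<bar> \<le> R" if "Complex x y \<in> K" for y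
    using R[OF that] abs_Im_le_cmod[of "Complex x y"] by simp
  define D where "D = {e \<in> darts. dart_sign x e \<noteq> 0}"
  have fD: "finite D" using finite_darts by (simp add: D_def)
  have sD: "(\<Sum>e \<in> darts. dart_sign x e * f e) = (\<Sum>e \<in> D. dart_sign x e * f e)" for f
    unfolding D_def by (rule sum.mono_neutral_right) (auto simp: finite_darts)
  have hR: "\<bar>dart_height x e\<bar> \<le> R" if "e \<in> D" for e
  proof -
    have "Complex x (dart_height x e) \<in> frontier K"
      using dart_point_frontier(1)[of e x] that x by (simp add: D_def)
    moreover have "frontier K \<subseteq> K" using compact compact_imp_closed frontier_subset_closed by blast
    ultimately show ?thesis using in_R by blast
  qed
  have ind: "indicator K (Complex x y) = (\<Sum>e \<in> D. dart_sign x e * of_bool (y < dart_height x e))"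
    if "y \<notin> dart_height x ` D" for y
    using slice_indicator[OF x, of y] that unfolding sD by (auto simp: D_def)
  \<comment> \<open>Evaluation of the slice formula at \<open>- R - 1\<close>, a point outside
    \<open>K\<close> that is below every dart on the line.\<close>
  have sum0: "(\<Sum>e \<in> D. dart_sign x e) = 0"
  proof -
    have lt: "- R - 1 < dart_height x e" if "e \<in> D" for e using hR[OF that] by linarith
    have "Complex x (- R - 1) \<notin> K" using in_R[of "- R - 1"] by auto
    then have "0 = (\<Sum>e \<in> D. dart_sign x e * of_bool (- R - 1 < dart_height x e))"
      using ind[of "- R - 1"] lt by (fastforce simp: indicator_def)
    also have "\<dots> = (\<Sum>e \<in> D. dart_sign x e)" using lt by (intro sum.cong) auto
    finally show ?thesis by simp
  qed
  have [measurable]: "(\<lambda>y. Complex x y) \<in> borel_measurable borel"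
    unfolding Complex_eq[abs_def] by measurable
  have [measurable]: "K \<in> sets borel" using compact by (simp add: borel_compact)
  have "AE y in lborel. y \<notin> dart_height x ` D"
    using fD by (intro AE_not_in finite_imp_null_set_lborel) simp
  then have ae: "AE y in lborel. indicator K (Complex x y) =
      (\<Sum>e \<in> D. dart_sign x e * indicator {- R..<dart_height x e} y)"
  proof eventually_elim
    case (elim y)
    show ?case
    proof (cases "- R \<le> y")
      case True
      then show ?thesis using ind[OF elim] by (simp add: indicator_def of_bool_def)
    next
      case False
      then have "Complex x y \<notin> K" using in_R[of y] by auto
      then show ?thesis using False by (simp add: indicator_def)
    qed
  qed
  have "has_bochner_integral lborel (indicator {- R..<dart_height x e}) (dart_height x e + R)" if "e \<in> D" for e
    using has_bochner_integral_real_indicator[of "{- R..<dart_height x e}" lborel] hR[OF that] by simp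
  then have "has_bochner_integral lborel
      (\<lambda>y. \<Sum>e \<in> D. dart_sign x e * indicator {- R..<dart_height x e} y)
      (\<Sum>e \<in> D. dart_sign x e * (dart_height x e + R))"
    by (intro has_bochner_integral_sum has_bochner_integral_mult_right) auto
  then have "(\<integral>y. (\<Sum>e \<in> D. dart_sign x e * indicator {- R..<dart_height x e} y) \<partial>lborel) =
      (\<Sum>e \<in> D. dart_sign x e * (dart_height x e + R))"
    by (rule has_bochner_integral_integral_eq)
  also have "\<dots> = (\<Sum>e \<in> D. dart_sign x e * dart_height x e)"
    using sum0 by (simp add: algebra_simps sum.distrib sum_distrib_left[symmetric])
  also have "\<dots> = (\<Sum>e \<in> darts. dart_sign x e * dart_height x e)" by (simp add: sD)
  finally show ?thesis
    by (subst integral_cong_AE[OF _ _ ae]) measurable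
qed

text \<open>Fubini over the vertical slices: every dart contributes the signed area beneath it. The
  abscissae of the nodes, where the slices are not controlled, form a finite and thus null
  set.\<close>

lemma measure_eq_sum_darts:
  "measure lebesgue K = (\<Sum>(a, b) \<in> darts. trapezoid a b)"
proof -
  have [measurable]: "K \<in> sets borel" using compact by (simp add: borel_compact)
  have [measurable]: "(\<lambda>(x, y). Complex x y) \<in> borel_measurable (lborel \<Otimes>\<^sub>M lborel)"
    unfolding Complex_eq[abs_def] by measurable
  have fin: "emeasure lborel K < \<infinity>" using emeasure_compact_finite[OF compact] by simp
  have m: "(indicator K :: complex \<Rightarrow> real) \<in> borel_measurable borel" by measurable
  have "integrable lborel (indicator K :: complex \<Rightarrow> real)"
    using fin by (intro integrable_real_indicator) auto
  then have I: "integrable (lborel \<Otimes>\<^sub>M lborel) (\<lambda>z. indicator K (case z of (x, y) \<Rightarrow> Complex x y) :: real)"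
    by (subst (asm) lborel_complex_eq_distr) (subst (asm) integrable_distr_eq, measurable)
  have "measure lborel K = (\<integral>z. indicator K z \<partial>lborel)" by simp
  also have "\<dots> = (\<integral>z. indicator K (case z of (x, y) \<Rightarrow> Complex x y) \<partial>(lborel \<Otimes>\<^sub>M lborel))"
    by (subst lborel_complex_eq_distr) (subst integral_distr, measurable)
  finally have E: "measure lborel K = (\<integral>z. indicator K (case z of (x, y) \<Rightarrow> Complex x y) \<partial>(lborel \<Otimes>\<^sub>M lborel))" .
  have S: "has_bochner_integral lborel (\<lambda>x. \<Sum>e \<in> darts. dart_sign x e * dart_height x e)
      (\<Sum>(a, b) \<in> darts. trapezoid a b)"
    by (intro has_bochner_integral_sum) (auto intro: integral_dart_slice)
  have "finite (Re ` \<Union>F)"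
    using finite_faces card_face by (metis card.infinite finite_Union finite_imageI zero_neq_numeral)
  then have "AE x in lborel. x \<notin> Re ` \<Union>F" by (intro AE_not_in finite_imp_null_set_lborel)
  then have ae: "AE x in lborel. (\<integral>y. indicator K (Complex x y) \<partial>lborel) = (\<Sum>e \<in> darts. dart_sign x e * dart_height x e)"
    by eventually_elim (rule slice_integral)
  have "measure lborel K = (\<integral>x. (\<integral>y. indicator K (Complex x y) \<partial>lborel) \<partial>lborel)"
    using lborel_pair.integral_fst'[OF I] E by simp
  also have "\<dots> = (\<integral>x. (\<Sum>e \<in> darts. dart_sign x e * dart_height x e) \<partial>lborel)"
  proof (rule integral_cong_AE[OF _ _ ae])
    show "(\<lambda>x. \<integral>y. indicat_real K (Complex x y) \<partial>lborel) \<in> borel_measurable lborel"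
      using lborel_pair.integrable_fst'[OF I] by (simp add: borel_measurable_integrable)
    show "(\<lambda>x. \<Sum>e \<in> darts. dart_sign x e * dart_height x e) \<in> borel_measurable lborel"
      using S unfolding has_bochner_integral_iff by (blast dest: borel_measurable_integrable)
  qed
  also have "\<dots> = (\<Sum>(a, b) \<in> darts. trapezoid a b)"
    using S by (rule has_bochner_integral_integral_eq)
  finally show ?thesis by simp
qed

end

section \<open>Directed cycles with hidden darts\<close>

lemma directed_cycle_closed:
  assumes "directed_cycle D" "x \<in> A" "x \<in> Field D" "\<And>a b. (a, b) \<in> D \<Longrightarrow> a \<in> A \<Longrightarrow> b \<in> A"
  shows "Field D \<subseteq> A"
proof
  fix y assume "y \<in> Field D"
  then have "(x, y) \<in> D\<^sup>*" using assms(1,3) by (simp add: directed_cycle_def)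
  then show "y \<in> A" by (induction rule: rtrancl_induct) (use assms(2,4) in auto)
qed

lemma directed_cycle_Domain: "directed_cycle D \<Longrightarrow> Domain D = Field D"
  and directed_cycle_Range: "directed_cycle D \<Longrightarrow> Range D = Field D"
  by (auto simp: directed_cycle_def Field_def)

text \<open>Successors in \<open>D'\<close> are unique, so from a node of \<open>D\<close> the
  larger cycle can only follow \<open>D\<close>; being a single orbit, it has no room for anything
  else.\<close>

lemma directed_cycle_subset_imp_eq:
  assumes "directed_cycle D" "directed_cycle D'" "D \<subseteq> D'" "D \<noteq> {}"
  shows "D = D'"
proof -
  have step: "(a, b) \<in> D" if ab: "(a, b) \<in> D'" "a \<in> Field D" for a b
  proof -
    obtain c where "(a, c) \<in> D" using ab(2) directed_cycle_Domain[OF assms(1)] by blast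
    then show ?thesis using ab(1) assms(2,3) by (metis directed_cycle_def single_valuedD subsetD)
  qed
  obtain x where "x \<in> Field D" using assms(4) by (auto simp: Field_def)
  moreover have "x \<in> Field D'" if "x \<in> Field D" for x using that assms(3) mono_Field[of D D'] by blast
  ultimately have "Field D' \<subseteq> Field D"
    using step by (intro directed_cycle_closed[OF assms(2), of x]) (auto intro: FieldI2)
  then have "D' \<subseteq> D" using step by (auto intro: FieldI1)
  with assms(3) show ?thesis by blast
qed

lemma directed_cycle_diff:
  assumes "directed_cycle D" "E \<subseteq> D"
  shows "Domain E \<inter> Domain (D - E) = {}" "Range E \<inter> Range (D - E) = {}"
    "Domain E \<union> Domain (D - E) = Field D" "Range E \<union> Range (D - E) = Field D"
proof -
  have sv: "single_valued D" "single_valued (D\<inverse>)" using assms(1) by (auto simp: directed_cycle_def)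
  show "Domain E \<inter> Domain (D - E) = {}" using sv(1) assms(2) by (auto dest: single_valuedD)
  show "Range E \<inter> Range (D - E) = {}"
  proof -
    have "a = b" if "(a, c) \<in> D" "(b, c) \<in> D" for a b c
      using sv(2) that by (auto simp: single_valued_def)
    then show ?thesis using assms(2) by blast
  qed
  show "Domain E \<union> Domain (D - E) = Field D" "Range E \<union> Range (D - E) = Field D"
    using assms(2) directed_cycle_Domain[OF assms(1)] directed_cycle_Range[OF assms(1)] by blast+
qed

text \<open>The right-hand sides mention \<open>E\<close> alone: any two completions of the same
  visible darts have hidden paths with the same starting nodes and the same end nodes.\<close>

lemma directed_cycle_diff_ends:
  assumes "directed_cycle D" "E \<subseteq> D"
  shows "Domain (D - E) - Range (D - E) = Range E - Domain E"
    "Range (D - E) - Domain (D - E) = Domain E - Range E"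
  using directed_cycle_diff[OF assms] by blast+

text \<open>Two hidden darts sharing a node form a path, since asymmetry forbids that they close up.
  Its middle node touches no visible dart. The number of ends, one or two of each kind, tells the
  cases apart from \<open>E\<close> alone.\<close>

lemma two_missing_darts:
  assumes D: "directed_cycle D" "E \<subseteq> D" and c: "card (D - E) = 2"
  obtains (adjacent) q b p where "D - E = {(q, b), (b, p)}" "q \<noteq> p" "q \<noteq> b" "b \<noteq> p"
      "Range E - Domain E = {q}" "Domain E - Range E = {p}"
      "Field D = insert b (Field E)" "b \<notin> Field E"
  | (apart) s t s' t' where "D - E = {(s, t), (s', t')}" "s \<noteq> s'" "t \<noteq> t'"
      "Range E - Domain E = {s, s'}" "Domain E - Range E = {t, t'}"
proof -
  note diff = directed_cycle_diff[OF D]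
  note ends = directed_cycle_diff_ends[OF D]
  obtain e e' where e: "D - E = {e, e'}" "e \<noteq> e'" using c unfolding card_2_iff by blast
  obtain s t s' t' where st: "e = (s, t)" "e' = (s', t')" by (metis surj_pair)
  have mem: "(s, t) \<in> D" "(s', t') \<in> D" using e st by auto
  have sv: "single_valued D" "single_valued (D\<inverse>)" and as: "\<And>x y. (x, y) \<in> D \<Longrightarrow> (y, x) \<notin> D"
    using D(1) by (auto simp: directed_cycle_def)
  have ne: "s \<noteq> t" "s' \<noteq> t'" using mem as by blast+
  have ss: "s \<noteq> s'" using mem sv(1) e st by (metis single_valuedD)
  have tt: "t \<noteq> t'" using mem sv(2) e st by (metis converseI single_valuedD)
  have not2: "\<not> (s = t' \<and> s' = t)" using mem as by blast
  have DR: "Domain (D - E) = {s, s'}" "Range (D - E) = {t, t'}" using e(1) st by auto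
  have adj: thesis if "D - E = {(q, b), (b, p)}" "q \<noteq> p" "q \<noteq> b" "b \<noteq> p" for q b p
  proof (rule adjacent[OF that])
    have X: "Domain (D - E) = {q, b}" "Range (D - E) = {b, p}" using that by auto
    show 1: "Range E - Domain E = {q}" "Domain E - Range E = {p}"
      unfolding ends[symmetric] X using that(2-4) by auto
    show "b \<notin> Field E" using diff(1,2) unfolding X Field_def by auto
    show "Field D = insert b (Field E)" using diff(3,4) 1 unfolding X Field_def by auto
  qed
  show thesis
  proof (cases "s = t' \<or> s' = t")
    case True
    then show thesis
    proof
      assume "s = t'"
      then show thesis using adj[of s' s t] e st ne not2 by (auto simp: insert_commute)
    next
      assume "s' = t"
      then show thesis using adj[of s t t'] e st ne not2 by auto
    qed
  next
    case False
    then have "Range E - Domain E = {s, s'}" "Domain E - Range E = {t, t'}"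
      unfolding ends[symmetric] DR using ne by auto
    then show thesis using apart[of s t s' t'] e st ss tt by simp
  qed
qed

lemma one_missing_dart:
  assumes D: "directed_cycle D" "E \<subseteq> D" and c: "card (D - E) = 1"
  obtains q p where "D - E = {(q, p)}" "Range E - Domain E = {q}" "Domain E - Range E = {p}"
proof -
  obtain q p where e: "D - E = {(q, p)}" using c by (metis card_1_singletonE surj_pair)
  then have "(q, p) \<in> D" by blast
  then have "q \<noteq> p" using D(1) by (auto simp: directed_cycle_def)
  moreover have "Range E - Domain E = Domain (D - E) - Range (D - E)"
    "Domain E - Range E = Range (D - E) - Domain (D - E)"
    using directed_cycle_diff_ends[OF D] by simp_all
  ultimately show thesis using that[OF e] unfolding e by auto
qed

text \<open>The visible darts form two paths. In \<open>D\<close> the one starting at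
  \<open>t\<close> must end at \<open>s'\<close>, since an end at \<open>s\<close> would close it up
  through the dart from \<open>s\<close> to \<open>t\<close>. But then the dart from
  \<open>s'\<close> to \<open>t\<close> closes it up in \<open>D'\<close>, leaving out
  \<open>s\<close>.\<close>

lemma no_crossed_reconnection:
  assumes D: "directed_cycle D" "D = E \<union> {(s, t), (s', t')}"
    and D': "directed_cycle D'" "D' = E \<union> {(s, t'), (s', t)}"
    and ends: "s \<notin> Domain E" "s' \<notin> Domain E" "s \<noteq> s'"
  shows False
proof -
  define A where "A = {x. (t, x) \<in> E\<^sup>*}"
  have E_closed: "b \<in> A" if "(a, b) \<in> E" "a \<in> A" for a b
    using that by (auto simp: A_def intro: rtrancl_into_rtrancl)
  have tA: "t \<in> A" by (simp add: A_def)
  have sv: "single_valued E"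
    using D by (auto simp: directed_cycle_def single_valued_def)
  \<comment> \<open>Visible paths do not branch, and neither \<open>s\<close> nor \<open>s'\<close>
    has a visible successor, so the path from \<open>t\<close> reaches at most one of them.\<close>
  have Not: "\<not> (s \<in> A \<and> s' \<in> A)"
  proof
    assume "s \<in> A \<and> s' \<in> A"
    then have "(s, s') \<in> E\<^sup>* \<or> (s', s) \<in> E\<^sup>*"
      using single_valued_confluent[OF sv, of t s s'] by (simp add: A_def)
    then show False using ends by (auto elim: converse_rtranclE)
  qed
  have F: "t \<in> Field D" "s' \<in> Field D" "t \<in> Field D'" "s \<in> Field D'"
    unfolding D(2) D'(2) by (auto simp: Field_def)
  have s'A: "s' \<in> A"
  proof (rule ccontr)
    assume "s' \<notin> A"
    then have "Field D \<subseteq> A"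
      using E_closed tA unfolding D(2) by (intro directed_cycle_closed[OF D(1)[unfolded D(2)], of t]) (auto simp: Field_def)
    then show False using F \<open>s' \<notin> A\<close> by blast
  qed
  then have "Field D' \<subseteq> A"
    using Not E_closed tA unfolding D'(2) by (intro directed_cycle_closed[OF D'(1)[unfolded D'(2)], of t]) (auto simp: Field_def)
  then show False using F Not s'A by blast
qed

text \<open>Both sets have the same number of elements, so equal means give equal sums.\<close>

lemma centroid_insert_inj:
  assumes "finite N" "b \<notin> N" "b' \<notin> N" "centroid (insert b N) = centroid (insert b' N)"
  shows "b = b'"
  using assms by (simp add: centroid_def)

text \<open>The last summand is the signed area of the triangle \<open>q\<close>, \<open>b\<close>,
  \<open>p\<close>.\<close>

lemma trapezoid_side: "trapezoid q b + trapezoid b p = trapezoid q p + side q b p / 2"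
  by (simp add: trapezoid_def side_def inner_complex_def field_simps)

text \<open>Equal ends force the two hidden darts into a path through some \<open>b\<close>, and
  equal areas then make the triangle on it degenerate, contrary to the true corners of a
  cell.\<close>

lemma one_vs_two_missing_darts:
  assumes D: "directed_cycle D" "E \<subseteq> D" "card (D - E) = 1"
    and D': "directed_cycle D'" "E \<subseteq> D'" "card (D' - E) = 2"
    and area: "(\<Sum>(a, b) \<in> D. trapezoid a b) = (\<Sum>(a, b) \<in> D'. trapezoid a b)"
    and corners: "\<And>a b c. (a, b) \<in> D' \<Longrightarrow> (b, c) \<in> D' \<Longrightarrow> a \<noteq> c \<Longrightarrow> \<not> collinear {a, b, c}"
  shows False
proof -
  have fin: "finite D" "finite D'" using D D' by (auto simp: directed_cycle_def)
  obtain q p where qp: "D - E = {(q, p)}" "Range E - Domain E = {q}" "Domain E - Range E = {p}"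
    using one_missing_dart[OF D] .
  show False using D'
  proof (cases rule: two_missing_darts)
    case (adjacent q' b p')
    with qp have eq: "q' = q" "p' = p" by auto
    have "(\<Sum>(a, b) \<in> D. trapezoid a b) = trapezoid q p + (\<Sum>(a, b) \<in> E. trapezoid a b)"
      using sum.subset_diff[OF D(2) fin(1), of "\<lambda>(a, b). trapezoid a b"] qp(1) by simp
    moreover have "(\<Sum>(a, b) \<in> D'. trapezoid a b) = trapezoid q b + trapezoid b p + (\<Sum>(a, b) \<in> E. trapezoid a b)"
      using sum.subset_diff[OF D'(2) fin(2), of "\<lambda>(a, b). trapezoid a b"] adjacent(1,3) eq by simp
    ultimately have "side q b p = 0" using area trapezoid_side[of q b p] by simp
    then have "collinear {q, b, p}" by (rule side_eq_0_imp_collinear)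
    moreover have "(q, b) \<in> D'" "(b, p) \<in> D'" using adjacent(1) eq by auto
    ultimately show False using corners adjacent(2) eq by blast
  next
    case (apart s t s' t')
    then show False using qp by auto
  qed
qed

text \<open>A path against separate darts fails on the number of ends. Two paths share ends and
  visible nodes, so the centroid fixes the middle node. Separate darts could only be paired
  differently, which \<open>no_crossed_reconnection\<close> rules out.\<close>

lemma two_vs_two_missing_darts:
  assumes D: "directed_cycle D" "E \<subseteq> D" "card (D - E) = 2"
    and D': "directed_cycle D'" "E \<subseteq> D'" "card (D' - E) = 2"
    and cent: "centroid (Field D) = centroid (Field D')"
  shows "D = D'"
proof -
  have "finite D" using D by (auto simp: directed_cycle_def)
  then have fE: "finite (Field E)" using D(2) finite_subset finite_Field by blast
  have "D - E = D' - E"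
    using D
  proof (cases rule: two_missing_darts)
    case 1: (adjacent q b p)
    show ?thesis using D'
    proof (cases rule: two_missing_darts)
      case 2: (adjacent q' b' p')
      have "b = b'" using centroid_insert_inj[OF fE 1(8) 2(8)] cent 1(7) 2(7) by simp
      then show ?thesis using 1 2 by auto
    next
      case 2: (apart s t s' t')
      then show ?thesis using 1 by auto
    qed
  next
    case 1: (apart s t s' t')
    show ?thesis using D'
    proof (cases rule: two_missing_darts)
      case 2: (adjacent q' b' p')
      then show ?thesis using 1 by auto
    next
      case 2: (apart u v u' v')
      have "\<not> (D' - E = {(s, t'), (s', t)})"
      proof
        assume A: "D' - E = {(s, t'), (s', t)}"
        have ends: "s \<notin> Domain E" "s' \<notin> Domain E" using 1(4) by blast+
        have "D = E \<union> {(s, t), (s', t')}" "D' = E \<union> {(s, t'), (s', t)}"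
          unfolding A[symmetric] 1(1)[symmetric] using D(2) D'(2) by blast+
        then show False by (intro no_crossed_reconnection[OF D(1) _ D'(1) _ ends 1(2)])
      qed
      moreover have "u = s \<and> u' = s' \<or> u = s' \<and> u' = s" "v = t \<and> v' = t' \<or> v = t' \<and> v' = t"
        using 1(4,5) 2(4,5) by (simp_all add: doubleton_eq_iff)
      then have "D' - E = {(s, t), (s', t')} \<or> D' - E = {(s, t'), (s', t)}"
        unfolding 2(1) by (elim disjE conjE) (simp_all add: insert_commute)
      ultimately show ?thesis using 1(1) by simp
    qed
  qed
  then show ?thesis using D(2) D'(2) by blast
qed

lemma directed_cycle_determined:
  assumes D: "directed_cycle D" "E \<subseteq> D" "card (D - E) \<le> 2" "D \<noteq> {}"
    and D': "directed_cycle D'" "E \<subseteq> D'" "card (D' - E) \<le> 2" "D' \<noteq> {}"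
    and cent: "centroid (Field D) = centroid (Field D')"
    and area: "(\<Sum>(a, b) \<in> D. trapezoid a b) = (\<Sum>(a, b) \<in> D'. trapezoid a b)"
    and corners: "\<And>a b c. (a, b) \<in> D \<Longrightarrow> (b, c) \<in> D \<Longrightarrow> a \<noteq> c \<Longrightarrow> \<not> collinear {a, b, c}"
    and corners': "\<And>a b c. (a, b) \<in> D' \<Longrightarrow> (b, c) \<in> D' \<Longrightarrow> a \<noteq> c \<Longrightarrow> \<not> collinear {a, b, c}"
  shows "D = D'"
proof -
  have fin: "finite D" "finite D'" using D(1) D'(1) by (auto simp: directed_cycle_def)
  \<comment> \<open>The first two cases cover every comparison in which one side hides nothing: that
    side is \<open>E\<close> and lies inside the other cycle.\<close>
  consider "card (D - E) = 0" | "card (D' - E) = 0" | "card (D - E) = 1" "card (D' - E) = 1"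
    | "card (D - E) = 1" "card (D' - E) = 2" | "card (D - E) = 2" "card (D' - E) = 1"
    | "card (D - E) = 2" "card (D' - E) = 2"
    using D(3) D'(3) by linarith
  then show ?thesis
  proof cases
    case 1
    then have "D \<subseteq> D'" using fin D'(2) by auto
    then show ?thesis using directed_cycle_subset_imp_eq D(1,4) D'(1) by blast
  next
    case 2
    then have "D' \<subseteq> D" using fin D(2) by auto
    then show ?thesis using directed_cycle_subset_imp_eq D(1) D'(1,4) by blast
  next
    case 3
    obtain q p where "D - E = {(q, p)}" "Range E - Domain E = {q}" "Domain E - Range E = {p}"
      using one_missing_dart[OF D(1,2) 3(1)] .
    moreover obtain q' p' where "D' - E = {(q', p')}" "Range E - Domain E = {q'}" "Domain E - Range E = {p'}"
      using one_missing_dart[OF D'(1,2) 3(2)] .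
    ultimately have "D - E = D' - E" by auto
    then show ?thesis using D(2) D'(2) by blast
  next
    case 4
    then show ?thesis using one_vs_two_missing_darts[OF D(1,2) _ D'(1,2) _ area corners'] by blast
  next
    case 5
    then show ?thesis using one_vs_two_missing_darts[OF D'(1,2) _ D(1,2) _ area[symmetric] corners] by blast
  next
    case 6
    then show ?thesis using two_vs_two_missing_darts D D' cent by blast
  qed
qed

section \<open>Reconstruction of the mesh\<close>

abbreviation translate_darts :: "complex \<Rightarrow> (complex \<times> complex) set \<Rightarrow> (complex \<times> complex) set" where
  "translate_darts \<tau> \<equiv> image (map_prod (\<lambda>p. p + \<tau>) (\<lambda>p. p + \<tau>))"

lemma translate_darts_iff: "(a + \<tau>, b + \<tau>) \<in> translate_darts \<tau> D \<longleftrightarrow> (a, b) \<in> D"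
  by auto

lemma Field_translate_darts: "Field (translate_darts \<tau> D) = (\<lambda>p. p + \<tau>) ` Field D"
  by (force simp: Field_def)

lemma directed_cycle_translate_darts:
  assumes "directed_cycle D"
  shows "directed_cycle (translate_darts \<tau> D)"
proof -
  have path: "(x + \<tau>, y + \<tau>) \<in> (translate_darts \<tau> D)\<^sup>*" if "(x, y) \<in> D\<^sup>*" for x y
    using that by (induction rule: rtrancl_induct) (auto simp: translate_darts_iff intro: rtrancl_into_rtrancl)
  show ?thesis unfolding directed_cycle_def
  proof (intro conjI allI impI ballI)
    show "finite (translate_darts \<tau> D)" "single_valued (translate_darts \<tau> D)"
      "single_valued ((translate_darts \<tau> D)\<inverse>)"
      using assms by (auto simp: directed_cycle_def single_valued_def)
    show "Domain (translate_darts \<tau> D) = Range (translate_darts \<tau> D)"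
      using assms by (force simp: directed_cycle_def)
    show "(y, x) \<notin> translate_darts \<tau> D" if "(x, y) \<in> translate_darts \<tau> D" for x y
      using that assms by (auto simp: directed_cycle_def)
    show "(x, y) \<in> (translate_darts \<tau> D)\<^sup>*"
      if "x \<in> Field (translate_darts \<tau> D)" "y \<in> Field (translate_darts \<tau> D)" for x y
      using that path assms unfolding Field_translate_darts by (auto simp: directed_cycle_def)
  qed
qed

lemma centroid_translate:
  assumes "finite N" "N \<noteq> {}"
  shows "centroid ((\<lambda>p. p + \<tau>) ` N) = centroid N + \<tau>"
proof -
  have "(\<Sum>b \<in> (\<lambda>p. p + \<tau>) ` N. b) = (\<Sum>b \<in> N. b) + real (card N) *\<^sub>R \<tau>"
    by (subst sum.reindex) (auto simp: sum.distrib scaleR_conv_of_real)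
  moreover have "card ((\<lambda>p. p + \<tau>) ` N) = card N" by (intro card_image) auto
  moreover have "real (card N) \<noteq> 0" using assms by simp
  ultimately show ?thesis by (simp add: centroid_def scaleR_add_right)
qed

text \<open>A horizontal shift changes no trapezoid. A vertical one adds
  \<open>(Re a - Re b) * Im \<tau>\<close> to each, and these terms cancel around the cycle because
  every node is the start of one dart and the end of one.\<close>

lemma sum_trapezoid_translate:
  assumes "directed_cycle D"
  shows "(\<Sum>(a, b) \<in> translate_darts \<tau> D. trapezoid a b) = (\<Sum>(a, b) \<in> D. trapezoid a b)"
proof -
  have sv: "single_valued D" "single_valued (D\<inverse>)" and DR: "Domain D = Range D"
    using assms by (auto simp: directed_cycle_def)
  have "inj_on fst D" using sv(1) by (auto simp: inj_on_def single_valued_def)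
  then have "(\<Sum>e \<in> D. Re (fst e)) = (\<Sum>x \<in> Domain D. Re x)" by (simp add: Domain_fst sum.reindex)
  also have "inj_on snd D" using sv(2) by (auto simp: inj_on_def single_valued_def)
  then have "(\<Sum>x \<in> Domain D. Re x) = (\<Sum>e \<in> D. Re (snd e))" by (simp add: DR Range_snd sum.reindex)
  finally have 0: "(\<Sum>e \<in> D. Re (fst e)) - (\<Sum>e \<in> D. Re (snd e)) = 0" by simp
  have "(\<Sum>(a, b) \<in> translate_darts \<tau> D. trapezoid a b) = (\<Sum>e \<in> D. trapezoid (fst e + \<tau>) (snd e + \<tau>))"
    by (subst sum.reindex) (auto simp: inj_on_def case_prod_beta)
  also have "\<dots> = (\<Sum>e \<in> D. trapezoid (fst e) (snd e) + (Re (fst e) - Re (snd e)) * Im \<tau>)"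
    by (intro sum.cong) (auto simp: trapezoid_def field_simps)
  also have "\<dots> = (\<Sum>e \<in> D. trapezoid (fst e) (snd e)) + ((\<Sum>e \<in> D. Re (fst e)) - (\<Sum>e \<in> D. Re (snd e))) * Im \<tau>"
    by (simp add: sum.distrib sum_subtractf flip: sum_distrib_right)
  finally show ?thesis by (simp add: 0 case_prod_beta)
qed

section \<open>From the graph data to the darts of each cell\<close>

abbreviation cell_darts :: "mesh \<Rightarrow> complex set \<Rightarrow> (complex \<times> complex) set" where
  "cell_darts M K \<equiv> polygonal_region.darts K (cell_faces M K)"

definition visible_darts :: "mesh \<Rightarrow> complex set \<Rightarrow> (complex \<times> complex) set" where
  "visible_darts M K = {(a, b) \<in> cell_darts M K. {a, b} \<notin> farfield_faces M}"

lemma is_meshD: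
  assumes "is_mesh M"
  shows "finite (faces M)" and "\<forall>f \<in> faces M. card f = 2"
    and "\<forall>f \<in> faces M. \<forall>g \<in> faces M. f \<noteq> g \<longrightarrow> convex hull f \<inter> convex hull g = f \<inter> g"
    and "\<forall>f \<in> faces M. \<exists>K \<in> cells M. f \<in> cell_faces M K"
    and "\<forall>K \<in> cells M. K \<noteq> {} \<and> compact K \<and> connected K \<and> closure (interior K) = K \<and>
        frontier K = (\<Union>f \<in> cell_faces M K. convex hull f)"
    and "\<forall>K \<in> cells M. \<forall>a b c. {a, b} \<in> cell_faces M K \<longrightarrow> {b, c} \<in> cell_faces M K \<longrightarrow> a \<noteq> c \<longrightarrow>
        \<not> collinear {a, b, c}"
    and "\<forall>K \<in> cells M. \<forall>L \<in> cells M. (K, L) \<in> (face_adjacent M)\<^sup>*"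
  using assms unfolding is_mesh_def by - (elim conjE, assumption)+

lemma polygonal_cell_of_mesh:
  assumes "is_mesh M" "K \<in> cells M" "singular_volume M K"
  shows "\<exists>vs. polygonal_cell K (cell_faces M K) vs"
proof -
  obtain vs where vs: "3 \<le> length vs" "distinct vs" "cell_faces M K = polygon_sides vs"
    using assms(3) by (auto simp: singular_volume_def)
  note mesh = is_meshD[OF assms(1)]
  have sub: "cell_faces M K \<subseteq> faces M" by (auto simp: cell_faces_def)
  have "polygonal_region K (cell_faces M K)"
  proof
    show "compact K" "closure (interior K) = K" "frontier K = (\<Union>f \<in> cell_faces M K. convex hull f)"
      using mesh(5) assms(2) by simp_all
    show "finite (cell_faces M K)" using finite_subset[OF sub mesh(1)] .
    show "card f = 2" "\<And>g. g \<in> cell_faces M K \<Longrightarrow> f \<noteq> g \<Longrightarrow> convex hull f \<inter> convex hull g = f \<inter> g"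
      if "f \<in> cell_faces M K" for f
      using mesh(2,3) that sub by blast+
  qed
  moreover have "polygonal_cell_axioms (cell_faces M K) vs"
  proof
    show "\<not> collinear {a, b, c}" if "{a, b} \<in> cell_faces M K" "{b, c} \<in> cell_faces M K" "a \<noteq> c" for a b c
      using mesh(6) assms(2) that by blast
  qed (use vs in auto)
  ultimately show ?thesis by (blast intro: polygonal_cell.intro)
qed

lemma cell_faces_eq_darts:
  assumes "polygonal_region K (cell_faces M K)"
  shows "cell_faces M K = (\<lambda>(a, b). {a, b}) ` cell_darts M K"
proof -
  interpret polygonal_region K "cell_faces M K" by fact
  show ?thesis
  proof (intro equalityI subsetI)
    fix f assume f: "f \<in> cell_faces M K"
    obtain p q where pq: "f = {p, q}" using card_face[OF f] unfolding card_2_iff by blast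
    then show "f \<in> (\<lambda>(a, b). {a, b}) ` darts" using darts_cases[of p q] f by (force simp: insert_commute)
  qed (auto simp: darts_face)
qed

text \<open>By asymmetry a face carries only one dart of the cell, so hidden darts inject into its
  farfield faces.\<close>

lemma card_hidden_darts:
  assumes "polygonal_region K (cell_faces M K)" "card (cell_faces M K \<inter> farfield_faces M) \<le> n"
  shows "card (cell_darts M K - visible_darts M K) \<le> n"
proof -
  interpret polygonal_region K "cell_faces M K" by fact
  have "inj_on (\<lambda>(a, b). {a, b}) (darts - visible_darts M K)"
    using darts_asym by (auto simp: inj_on_def doubleton_eq_iff)
  moreover have "(\<lambda>(a, b). {a, b}) ` (darts - visible_darts M K) \<subseteq> cell_faces M K \<inter> farfield_faces M"
    using darts_face by (auto simp: visible_darts_def)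
  ultimately have "card (darts - visible_darts M K) \<le> card (cell_faces M K \<inter> farfield_faces M)"
    using finite_faces by (intro card_inj_on_le) auto
  then show ?thesis using assms(2) by simp
qed

text \<open>Such a face either bounds an object, giving an edge to its own graph node, or has a
  second cell on its other side.\<close>

lemma ex_edge_of_visible_face:
  assumes "K \<in> cells M" "f \<in> cell_faces M K" "f \<notin> farfield_faces M"
  shows "\<exists>v \<in> graph_nodes M. f \<in> edge_faces M (Cell K) v"
proof (cases "f \<in> boundary_faces M")
  case True
  then have "f \<in> geometry_faces M" using assms(3) by (simp add: geometry_faces_def)
  then show ?thesis using assms by (intro bexI[of _ "Geo f"]) (auto simp: graph_nodes_def)
next
  case False
  then obtain L where "L \<in> cells M" "f \<in> cell_faces M L" "K \<noteq> L"
    using assms(1,2) by (auto simp: boundary_faces_def)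
  then show ?thesis using assms by (intro bexI[of _ "Cell L"]) (auto simp: graph_nodes_def)
qed

lemma edge_faces_Cell:
  assumes "f \<in> edge_faces M (Cell K) v"
  shows "K \<in> cells M" "f \<in> cell_faces M K" "f \<notin> farfield_faces M"
proof -
  show "K \<in> cells M" "f \<in> cell_faces M K" using assms by (cases v; auto)+
  show "f \<notin> farfield_faces M"
    using assms by (cases v) (auto simp: geometry_faces_def farfield_faces_def boundary_faces_def)
qed

lemma centroid_pair: "a \<noteq> b \<Longrightarrow> centroid {a, b} = (a + b) /\<^sub>R 2"
  by (simp add: centroid_def)

text \<open>The triple of the face reappears among the data of the other mesh, and a triple
  determines the dart relative to the cell centroid: the normal yields \<open>b - a\<close>, the
  face centroid \<open>a + b\<close>. The two meshes enter symmetrically, so that the lemma serves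
  in both directions.\<close>

lemma visible_dart_transfer:
  assumes d: "(a, b) \<in> cell_darts M K" and f: "{a, b} \<in> edge_faces M (Cell K) v"
    and eq: "edge_data M (Cell K) v = edge_data M' (Cell K') v'"
    and K: "polygonal_region K (cell_faces M K)"
    and K': "K' \<in> cells M' \<Longrightarrow> polygonal_region K' (cell_faces M' K')"
    and \<tau>: "\<tau> = location M' (Cell K') - location M (Cell K)"
  shows "(a + \<tau>, b + \<tau>) \<in> visible_darts M' K'"
proof -
  have "(area_normal K {a, b}, centroid {a, b} - location M (Cell K), centroid {a, b} - location M v)
      \<in> edge_data M (Cell K) v"
    using f by (auto simp: edge_data_def)
  then obtain f' where f': "f' \<in> edge_faces M' (Cell K') v'" "area_normal K {a, b} = area_normal K' f'"
      "centroid {a, b} - location M (Cell K) = centroid f' - location M' (Cell K')"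
    unfolding eq by (auto simp: edge_data_def)
  note vis = edge_faces_Cell[OF f'(1)]
  interpret R: polygonal_region K "cell_faces M K" by (rule K)
  interpret R': polygonal_region K' "cell_faces M' K'" by (rule K'[OF vis(1)])
  obtain a' b' where d': "(a', b') \<in> R'.darts" "f' = {a', b'}"
  proof -
    have "f' \<in> (\<lambda>(a, b). {a, b}) ` R'.darts"
      by (rule subsetD[OF equalityD1[OF cell_faces_eq_darts[OF K'[OF vis(1)]]] vis(2)])
    then show thesis using that by (elim imageE) (auto simp: case_prod_beta)
  qed
  have e1: "b - a = b' - a'"
    using f'(2) R.area_normal_dart[OF d] R'.area_normal_dart[OF d'(1)] d'(2) by simp
  have "a \<noteq> b" "a' \<noteq> b'"
    using R.face_neq[OF R.darts_face[OF d]] R'.face_neq[OF R'.darts_face[OF d'(1)]] by simp_all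
  then have c: "centroid {a, b} = (a + b) /\<^sub>R 2" "centroid {a', b'} = (a' + b') /\<^sub>R 2"
    by (simp_all add: centroid_pair)
  have "x + (l' - l) = y" if "x - l = y - l'" for x y l l' :: complex
    using that by (simp add: algebra_simps)
  from this[OF f'(3)] have "(a + b) /\<^sub>R 2 + \<tau> = (a' + b') /\<^sub>R 2"
    unfolding d'(2) \<tau> c .
  then have "2 *\<^sub>R ((a + b) /\<^sub>R 2 + \<tau>) = 2 *\<^sub>R ((a' + b') /\<^sub>R 2)" by (rule arg_cong)
  then have e2: "a + b + (\<tau> + \<tau>) = a' + b'" by (simp add: scaleR_add_right scaleR_2)
  have "2 * a' = 2 * (a + \<tau>)" "2 * b' = 2 * (b + \<tau>)" using e1 e2 by algebra+
  then have "a' = a + \<tau>" "b' = b + \<tau>" unfolding mult_cancel_left by simp_all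
  then show ?thesis using d' vis by (simp add: visible_darts_def)
qed

text \<open>\<open>directed_cycle_determined\<close>, applied to the translated darts of
  \<open>K\<close> and the darts of \<open>K'\<close>, with the visible darts of \<open>K'\<close>
  as the common part. Area is insensitive to the translation, the centroid moves along with
  it.\<close>

lemma cell_determined:
  assumes K: "polygonal_cell K (cell_faces M K) vs" "card (cell_faces M K \<inter> farfield_faces M) \<le> 2"
    and K': "polygonal_cell K' (cell_faces M' K') vs'" "card (cell_faces M' K' \<inter> farfield_faces M') \<le> 2"
    and vis: "visible_darts M' K' = translate_darts \<tau> (visible_darts M K)"
    and cent: "centroid (cell_nodes M' K') = centroid (cell_nodes M K) + \<tau>"
    and vol: "measure lebesgue K = measure lebesgue K'"
  shows "cell_faces M' K' = image (\<lambda>p. p + \<tau>) ` cell_faces M K"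
proof -
  interpret C: polygonal_cell K "cell_faces M K" vs by fact
  interpret C': polygonal_cell K' "cell_faces M' K'" vs' by fact
  have cyc: "directed_cycle (translate_darts \<tau> C.darts)"
    by (rule directed_cycle_translate_darts[OF C.directed_cycle_darts])
  have ne: "C.darts \<noteq> {}" "C'.darts \<noteq> {}"
    by (rule C.darts_nonempty C'.darts_nonempty)+
  have hidden: "translate_darts \<tau> C.darts - visible_darts M' K' = translate_darts \<tau> (C.darts - visible_darts M K)"
    unfolding vis by (intro image_set_diff[symmetric]) (auto simp: inj_on_def)
  have eq: "translate_darts \<tau> C.darts = C'.darts"
  proof (rule directed_cycle_determined[OF cyc _ _ _ C'.directed_cycle_darts])
    show "visible_darts M' K' \<subseteq> translate_darts \<tau> C.darts" unfolding vis by (auto simp: visible_darts_def)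
    have "card (C.darts - visible_darts M K) \<le> 2"
      using card_hidden_darts[OF C.polygonal_region_axioms K(2)] .
    then show "card (translate_darts \<tau> C.darts - visible_darts M' K') \<le> 2"
      unfolding hidden using card_image_le[of "C.darts - visible_darts M K"] C.finite_darts
      by (meson finite_Diff order_trans)
    show "card (C'.darts - visible_darts M' K') \<le> 2"
      using card_hidden_darts[OF C'.polygonal_region_axioms K'(2)] .
    show "visible_darts M' K' \<subseteq> C'.darts" by (auto simp: visible_darts_def)
    show "translate_darts \<tau> C.darts \<noteq> {}" "C'.darts \<noteq> {}" using ne by auto
    have "finite (Field C.darts)" using C.finite_darts by (rule finite_Field)
    moreover have "Field C.darts \<noteq> {}" using ne(1) by (auto simp: Field_def)
    ultimately show "centroid (Field (translate_darts \<tau> C.darts)) = centroid (Field C'.darts)"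
      using cent by (simp add: Field_translate_darts centroid_translate C.Field_darts C'.Field_darts cell_nodes_def)
    show "(\<Sum>(a, b) \<in> translate_darts \<tau> C.darts. trapezoid a b) = (\<Sum>(a, b) \<in> C'.darts. trapezoid a b)"
      using vol C.measure_eq_sum_darts C'.measure_eq_sum_darts
      by (simp add: sum_trapezoid_translate[OF C.directed_cycle_darts])
    show "\<not> collinear {a, b, c}" if "(a, b) \<in> C'.darts" "(b, c) \<in> C'.darts" "a \<noteq> c" for a b c
      using C'.corners C'.darts_face that by blast
    show "\<not> collinear {a, b, c}"
      if abc: "(a, b) \<in> translate_darts \<tau> C.darts" "(b, c) \<in> translate_darts \<tau> C.darts" "a \<noteq> c" for a b c
    proof -
      obtain p q r where pqr: "a = p + \<tau>" "b = q + \<tau>" "c = r + \<tau>" "(p, q) \<in> C.darts" "(q, r) \<in> C.darts"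
        using abc by auto
      then have "\<not> collinear {p, q, r}" using C.corners C.darts_face abc(3) by blast
      then show ?thesis by (simp add: pqr(1-3) collinear_def)
    qed
  qed
  have "cell_faces M' K' = (\<lambda>(a, b). {a, b}) ` translate_darts \<tau> C.darts"
    unfolding eq by (rule cell_faces_eq_darts[OF C'.polygonal_region_axioms])
  also have "\<dots> = image (\<lambda>p. p + \<tau>) ` (\<lambda>(a, b). {a, b}) ` C.darts"
    by (force simp: image_image)
  also have "\<dots> = image (\<lambda>p. p + \<tau>) ` cell_faces M K"
    by (rule arg_cong[OF cell_faces_eq_darts[OF C.polygonal_region_axioms, symmetric]])
  finally show ?thesis .
qed

lemma faces_eq_Union_cell_faces:
  assumes "is_mesh M"
  shows "faces M = (\<Union>K \<in> cells M. cell_faces M K)"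
  using is_meshD(4)[OF assms] by (auto simp: cell_faces_def)

theorem theorem3p1:
  fixes M M' :: mesh and \<phi> :: "graph_node \<Rightarrow> graph_node"
  assumes "is_mesh M" and "is_mesh M'"
    and "\<forall>K \<in> cells M. card (cell_faces M K \<inter> farfield_faces M) \<le> 2"
    and "\<forall>K \<in> cells M'. card (cell_faces M' K \<inter> farfield_faces M') \<le> 2"
    and "\<forall>K \<in> cells M. singular_volume M K"
    and "\<forall>K \<in> cells M'. singular_volume M' K"
    and same_graph: "graph_iso M M' \<phi>"
    and same_volumes: "\<forall>K \<in> cells M. \<forall>K' \<in> cells M'. \<phi> (Cell K) = Cell K' \<longrightarrow>
           measure lebesgue K = measure lebesgue K'"
    and same_edge_data: "\<forall>(u, v) \<in> graph_edges M. edge_data M u v = edge_data M' (\<phi> u) (\<phi> v)"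
  shows "\<exists>\<alpha>. (\<lambda>p. p + \<alpha>) ` mesh_nodes M = mesh_nodes M' \<and>
             (\<lambda>f. (\<lambda>p. p + \<alpha>) ` f) ` faces M = faces M'"
proof -
  \<comment> \<open>The map induced on cells; it is meaningful because the identification of graph
    nodes preserves their type.\<close>
  define \<psi> where "\<psi> K = (THE K'. \<phi> (Cell K) = Cell K')" for K
  have bij: "bij_betw \<phi> (graph_nodes M) (graph_nodes M')"
    and types: "\<And>u. u \<in> graph_nodes M \<Longrightarrow> is_Cell (\<phi> u) \<longleftrightarrow> is_Cell u"
    and edges: "\<And>u v. u \<in> graph_nodes M \<Longrightarrow> v \<in> graph_nodes M \<Longrightarrow>
        (\<phi> u, \<phi> v) \<in> graph_edges M' \<longleftrightarrow> (u, v) \<in> graph_edges M"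
    using same_graph by (auto simp: graph_iso_def)
  have node: "Cell K \<in> graph_nodes N \<longleftrightarrow> K \<in> cells N" for K N by (auto simp: graph_nodes_def)
  have \<psi>: "\<phi> (Cell K) = Cell (\<psi> K)" "\<psi> K \<in> cells M'" if K: "K \<in> cells M" for K
  proof -
    have "\<phi> (Cell K) \<in> graph_nodes M'" using bij K node by (meson bij_betwE)
    moreover have "is_Cell (\<phi> (Cell K))" using types[of "Cell K"] K node by simp
    ultimately obtain K' where K': "\<phi> (Cell K) = Cell K'" by (cases "\<phi> (Cell K)") auto
    then have "\<psi> K = K'" by (simp add: \<psi>_def)
    then show "\<phi> (Cell K) = Cell (\<psi> K)" "\<psi> K \<in> cells M'"
      using K' \<open>\<phi> (Cell K) \<in> graph_nodes M'\<close> node by simp_all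
  qed
  have \<psi>_surj: "\<psi> ` cells M = cells M'"
  proof
    show "\<psi> ` cells M \<subseteq> cells M'" using \<psi> by auto
    show "cells M' \<subseteq> \<psi> ` cells M"
    proof
      fix K' assume "K' \<in> cells M'"
      then obtain u where u: "u \<in> graph_nodes M" "\<phi> u = Cell K'"
        using bij node by (metis bij_betw_imp_surj_on imageE)
      then have "is_Cell u" using types[OF u(1)] by simp
      then obtain K where "u = Cell K" by (cases u) auto
      then show "K' \<in> \<psi> ` cells M" using u \<psi>[of K] node by auto
    qed
  qed
  have data: "edge_data M u v = edge_data M' (\<phi> u) (\<phi> v)" if "f \<in> edge_faces M u v" for f u v
    using same_edge_data that by (auto simp: graph_edges_def)
  \<comment> \<open>The displacement of the centroid of each cell. A priori it depends on the cell,
    as the data are relative to the individual centroids.\<close>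
  define \<tau> where "\<tau> K = location M' (Cell (\<psi> K)) - location M (Cell K)" for K
  have region: "polygonal_region K (cell_faces M K)" if "K \<in> cells M" for K
    using polygonal_cell_of_mesh that assms(1,5) by (metis polygonal_cell_def)
  have region': "polygonal_region K (cell_faces M' K)" if "K \<in> cells M'" for K
    using polygonal_cell_of_mesh that assms(2,6) by (metis polygonal_cell_def)
  have cell: "cell_faces M' (\<psi> K) = image (\<lambda>p. p + \<tau> K) ` cell_faces M K" if K: "K \<in> cells M" for K
  proof -
    obtain vs where vs: "polygonal_cell K (cell_faces M K) vs"
      using polygonal_cell_of_mesh K assms(1,5) by blast
    obtain vs' where vs': "polygonal_cell (\<psi> K) (cell_faces M' (\<psi> K)) vs'"
      using polygonal_cell_of_mesh \<psi>(2)[OF K] assms(2,6) by blast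
    have fwd: "(a + \<tau> K, b + \<tau> K) \<in> visible_darts M' (\<psi> K)" if "(a, b) \<in> visible_darts M K" for a b
    proof -
      have d: "(a, b) \<in> cell_darts M K" and "{a, b} \<notin> farfield_faces M" using that by (auto simp: visible_darts_def)
      moreover have "{a, b} \<in> cell_faces M K" using polygonal_region.darts_face[OF region[OF K] d] .
      ultimately obtain v where v: "{a, b} \<in> edge_faces M (Cell K) v"
        using ex_edge_of_visible_face K by blast
      show ?thesis
        using visible_dart_transfer[OF d v data[OF v, unfolded \<psi>(1)[OF K]] region[OF K] region' \<tau>_def] .
    qed
    \<comment> \<open>The equality of data is given along the edges of \<open>M\<close> only, so the
      edge of the visible face in \<open>M'\<close> is first pulled back along the
      isomorphism.\<close>
    have bwd: "(a - \<tau> K, b - \<tau> K) \<in> visible_darts M K" if "(a, b) \<in> visible_darts M' (\<psi> K)" for a b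
    proof -
      note K' = \<psi>(2)[OF K]
      have d: "(a, b) \<in> cell_darts M' (\<psi> K)" and "{a, b} \<notin> farfield_faces M'"
        using that by (auto simp: visible_darts_def)
      moreover have "{a, b} \<in> cell_faces M' (\<psi> K)" using polygonal_region.darts_face[OF region'[OF K'] d] .
      ultimately obtain v' where v': "v' \<in> graph_nodes M'" "{a, b} \<in> edge_faces M' (Cell (\<psi> K)) v'"
        using ex_edge_of_visible_face K' by blast
      obtain v where v: "v \<in> graph_nodes M" "v' = \<phi> v"
        using v'(1) bij by (metis bij_betw_imp_surj_on imageE)
      have "(\<phi> (Cell K), \<phi> v) \<in> graph_edges M'"
        using v'(2) by (auto simp: graph_edges_def v(2) \<psi>(1)[OF K])
      then have "(Cell K, v) \<in> graph_edges M" using edges K node v(1) by blast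
      then have "edge_data M' (Cell (\<psi> K)) v' = edge_data M (Cell K) v"
        using same_edge_data by (auto simp: \<psi>(1)[OF K] v(2))
      moreover have "- \<tau> K = location M (Cell K) - location M' (Cell (\<psi> K))" by (simp add: \<tau>_def)
      ultimately have "(a + - \<tau> K, b + - \<tau> K) \<in> visible_darts M K"
        using visible_dart_transfer[OF d v'(2) _ region'[OF K'] region] by blast
      then show ?thesis by simp
    qed
    have "visible_darts M' (\<psi> K) = translate_darts (\<tau> K) (visible_darts M K)"
    proof (intro equalityI subrelI)
      fix a b assume "(a, b) \<in> visible_darts M' (\<psi> K)"
      then show "(a, b) \<in> translate_darts (\<tau> K) (visible_darts M K)"
        using bwd translate_darts_iff[of "a - \<tau> K" "\<tau> K" "b - \<tau> K"] by simp
    qed (use fwd in auto)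
    then show ?thesis
      using vs vs' K \<psi>[OF K] assms(3,4) same_volumes
      by (intro cell_determined[OF vs _ vs']) (auto simp: \<tau>_def)
  qed
  have step: "\<tau> K = \<tau> L" if adj: "(K, L) \<in> face_adjacent M" for K L
  proof (cases "K = L")
    case False
    then obtain f where f: "f \<in> edge_faces M (Cell K) (Cell L)" and KL: "K \<in> cells M" "L \<in> cells M"
      using adj by (auto simp: face_adjacent_def)
    have "(edge_normal (Cell K) (Cell L) f, centroid f - location M (Cell K), centroid f - location M (Cell L))
        \<in> edge_data M (Cell K) (Cell L)"
      unfolding edge_data_def using f by (rule imageI)
    then have "(edge_normal (Cell K) (Cell L) f, centroid f - location M (Cell K), centroid f - location M (Cell L))
        \<in> edge_data M' (Cell (\<psi> K)) (Cell (\<psi> L))"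
      using data[OF f] \<psi>(1) KL by simp
    \<comment> \<open>One triple holds the offsets from both centroids, so both equations concern
      the same \<open>f'\<close>; subtracting each from the position of \<open>f\<close> shows that
      the displacements of the two cells are equal.\<close>
    then obtain f' where "centroid f - location M (Cell K) = centroid f' - location M' (Cell (\<psi> K))"
        "centroid f - location M (Cell L) = centroid f' - location M' (Cell (\<psi> L))"
      unfolding edge_data_def by blast
    then show ?thesis unfolding \<tau>_def by (metis (no_types, opaque_lifting) diff_diff_eq2 diff_add_cancel add_diff_cancel_left' add.commute)
  qed simp
  have "\<exists>\<alpha>. \<forall>K \<in> cells M. \<tau> K = \<alpha>"
  \<comment> \<open>Without cells there are no faces either, and any translation will do.\<close>
  proof (cases "cells M = {}")
    case False
    then obtain K0 where K0: "K0 \<in> cells M" by blast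
    have "\<tau> K = \<tau> K0" if "K \<in> cells M" for K
    proof -
      have "(K0, K) \<in> (face_adjacent M)\<^sup>*" using is_meshD(7)[OF assms(1)] K0 that by blast
      then show ?thesis by (induction rule: rtrancl_induct) (use step in auto)
    qed
    then show ?thesis by blast
  qed simp
  then obtain \<alpha> where \<alpha>: "\<And>K. K \<in> cells M \<Longrightarrow> \<tau> K = \<alpha>" by blast
  have "faces M' = (\<Union>K \<in> cells M. cell_faces M' (\<psi> K))"
    using faces_eq_Union_cell_faces[OF assms(2)] unfolding \<psi>_surj[symmetric] by simp
  also have "\<dots> = image (\<lambda>p. p + \<alpha>) ` faces M"
    using cell \<alpha> faces_eq_Union_cell_faces[OF assms(1)] by (simp add: image_UN)
  finally have faces: "image (\<lambda>p. p + \<alpha>) ` faces M = faces M'" by simp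
  moreover have "(\<lambda>p. p + \<alpha>) ` mesh_nodes M = mesh_nodes M'"
    unfolding mesh_nodes_def faces[symmetric] by (simp add: image_Union)
  ultimately show ?thesis by blast
qed

end
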